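(* Let $\mathfrak A$ be a finite von Neumann algebra and $T\in\mathfrak A$. Then there exists an idempotent $P\in\mathfrak A$ such that $T-P$ is invertible (in $\mathfrak A$) and $\|(T-P)^{-1}\|\le 4$. In particular, $\mathfrak A$ is clean.
   Context: A unital ring is clean if every element can be written as the sum of an invertible element and an idempotent. *)

theory Defs
  imports "HOL-Analysis.Analysis"
begin

class complex_hilbert = banach +
  fixes cscale :: "complex \<Rightarrow> 'a \<Rightarrow> 'a"
    and cinner :: "'a \<Rightarrow> 'a \<Rightarrow> complex"
  assumes cscale_add_right: "cscale a (x + y) = cscale a x + cscale a y"
    and cscale_add_left: "cscale (a + b) x = cscale a x + cscale b x"
    and cscale_cscale: "cscale a (cscale b x) = cscale (a * b) x"
    and cscale_one: "cscale 1 x = x"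
    and scaleR_cscale: "scaleR r x = cscale (complex_of_real r) x"
    and cinner_commute: "cinner x y = cnj (cinner y x)"
    and cinner_add_right: "cinner x (y + z) = cinner x y + cinner x z"
    and cinner_cscale_right: "cinner x (cscale a y) = a * cinner x y"
    and cinner_self: "cinner x x = complex_of_real ((norm x)\<^sup>2)"

definition bounded_op :: "('a::complex_hilbert \<Rightarrow> 'a) \<Rightarrow> bool" where
  "bounded_op T \<longleftrightarrow> bounded_linear T \<and> (\<forall>c x. T (cscale c x) = cscale c (T x))"

definition adjoint :: "('a::complex_hilbert \<Rightarrow> 'a) \<Rightarrow> ('a \<Rightarrow> 'a)" where
  "adjoint T = (SOME S. \<forall>x y. cinner (T x) y = cinner x (S y))"

definition commutant :: "('a::complex_hilbert \<Rightarrow> 'a) set \<Rightarrow> ('a \<Rightarrow> 'a) set" where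
  "commutant M = {T. bounded_op T \<and> (\<forall>S\<in>M. T \<circ> S = S \<circ> T)}"

definition von_neumann_algebra :: "('a::complex_hilbert \<Rightarrow> 'a) set \<Rightarrow> bool" where
  "von_neumann_algebra M \<longleftrightarrow>
     (\<forall>T\<in>M. bounded_op T) \<and> id \<in> M \<and>
     (\<forall>S\<in>M. \<forall>T\<in>M. (\<lambda>x. S x + T x) \<in> M \<and> S \<circ> T \<in> M) \<and>
     (\<forall>c. \<forall>T\<in>M. (\<lambda>x. cscale c (T x)) \<in> M) \<and>
     (\<forall>T\<in>M. adjoint T \<in> M) \<and>
     commutant (commutant M) = M"

text \<open>Finite: the identity is a finite projection, i.e. it is not Murray--von Neumann
equivalent (via a partial isometry in M) to a subprojection different from it;
equivalently every isometry in M is a unitary.\<close>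
definition finite_vna :: "('a::complex_hilbert \<Rightarrow> 'a) set \<Rightarrow> bool" where
  "finite_vna M \<longleftrightarrow> von_neumann_algebra M \<and>
     (\<forall>V\<in>M. adjoint V \<circ> V = id \<longrightarrow> V \<circ> adjoint V = id)"

definition idempotent_in :: "('a \<Rightarrow> 'a) set \<Rightarrow> ('a \<Rightarrow> 'a) \<Rightarrow> bool" where
  "idempotent_in M P \<longleftrightarrow> P \<in> M \<and> P \<circ> P = P"

definition invertible_in :: "('a \<Rightarrow> 'a) set \<Rightarrow> ('a \<Rightarrow> 'a) \<Rightarrow> bool" where
  "invertible_in M U \<longleftrightarrow> U \<in> M \<and> (\<exists>S\<in>M. S \<circ> U = id \<and> U \<circ> S = id)"

definition clean_alg :: "('a::complex_hilbert \<Rightarrow> 'a) set \<Rightarrow> bool" where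
  "clean_alg M \<longleftrightarrow> (\<forall>T\<in>M. \<exists>U P. invertible_in M U \<and> idempotent_in M P \<and> T = (\<lambda>x. U x + P x))"

end

(*
Let e be the spectral projection of T*T for [0, 1/4] and T = U|T| a polar decomposition with U unitary,
which exists because M is finite. Then T maps e into f = U e U* with norm at most 1/2, and the
complement of e into the complement of f with lower bound 1/2. An idempotent P with kernel (1 - e)H makes
T - P block triangular for these splittings, so its range only has to be a complement of both (1 - e)H
and (1 - f)H in a quantitative sense. Such a range is the graph of 2 (1 - e) W over e, where W is a
unitary in M carrying e to f that extends the polar part of f e. This gives
norm ((T - P) x) >= norm x / 4, and in a finite algebra elements bounded below are invertible.
*)

theory Submission
  imports Defs
begin

section \<open>Geometry of complex Hilbert spaces\<close>

text \<open>The choice \<open>P = e\<close> already fails for 2 by 2 matrices: if T sends the first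
  basis vector to 0 and the second to the first, then e projects onto the first and T - e has rank
  one. The part of T that is large may cover eH, so the range of P has to be tilted towards fH.
  Slope 1 does not suffice for the constant 4: when e and f are orthogonal, the lower bound can fall
  to about 1/sqrt 20. The analytic objects (absolute values, spectral subspaces, polar parts,
  inverses) enter M through the bicommutant, so each is built canonically enough to commute with the
  commutant of M. Partial isometries are handled as relations stable under the commutant; maximality
  of such a relation takes the place of the comparison theory of projections. Finiteness enters only
  as the statement that isometries in M are onto.\<close>

lemma cinner_add_left: "cinner (x + y) z = cinner x z + cinner y z"
  by (metis cinner_add_right cinner_commute complex_cnj_add)

lemma cinner_cscale_left: "cinner (cscale a x) y = cnj a * cinner x y"
  by (metis cinner_commute cinner_cscale_right complex_cnj_mult)

lemma cinner_scaleR_right: "cinner x (r *\<^sub>R y) = r *\<^sub>R cinner x y"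
  by (simp add: scaleR_cscale cinner_cscale_right scaleR_conv_of_real)

lemma cinner_scaleR_left: "cinner (r *\<^sub>R x) y = r *\<^sub>R cinner x y"
  by (simp add: scaleR_cscale cinner_cscale_left scaleR_conv_of_real)

lemma cinner_zero_right [simp]: "cinner x 0 = 0"
  using cinner_scaleR_right[of x 0 0] by simp

lemma cinner_zero_left [simp]: "cinner 0 x = 0"
  using cinner_scaleR_left[of 0 0 x] by simp

lemma cinner_minus_right: "cinner x (- y) = - cinner x y"
  using cinner_scaleR_right[of x "-1" y] by simp

lemma cinner_minus_left: "cinner (- x) y = - cinner x y"
  using cinner_scaleR_left[of "-1" x y] by simp

lemma cinner_diff_right: "cinner x (y - z) = cinner x y - cinner x z"
  using cinner_add_right[of x y "- z"] by (simp add: cinner_minus_right)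

lemma cinner_diff_left: "cinner (x - y) z = cinner x z - cinner y z"
  using cinner_add_left[of x "- y" z] by (simp add: cinner_minus_left)

lemmas cinner_simps = cinner_add_left cinner_add_right cinner_diff_left cinner_diff_right
  cinner_scaleR_left cinner_scaleR_right cinner_minus_left cinner_minus_right

lemma cinner_eq_zero_commute: "cinner x y = 0 \<longleftrightarrow> cinner y x = 0"
  by (metis cinner_commute complex_cnj_zero)

lemma cinner_self_eq_zero [simp]: "cinner x x = 0 \<longleftrightarrow> x = 0"
  by (simp add: cinner_self)

lemma Re_cinner_commute: "Re (cinner x y) = Re (cinner y x)"
  by (subst cinner_commute) simp

lemma norm_sq_cinner: "(norm x)\<^sup>2 = Re (cinner x x)"
  by (simp add: cinner_self)

lemma cinner_eqI:
  assumes "\<And>z. cinner z x = cinner z y"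
  shows "x = y"
proof -
  have "cinner (x - y) (x - y) = 0"
    using assms[of "x - y"] by (simp add: cinner_diff_right)
  then show ?thesis by simp
qed

lemma norm_sq_add: "(norm (x + y))\<^sup>2 = (norm x)\<^sup>2 + (norm y)\<^sup>2 + 2 * Re (cinner x y)"
  using Re_cinner_commute[of x y] by (simp add: norm_sq_cinner cinner_simps)

lemma norm_sq_diff: "(norm (x - y))\<^sup>2 = (norm x)\<^sup>2 + (norm y)\<^sup>2 - 2 * Re (cinner x y)"
  using Re_cinner_commute[of x y] by (simp add: norm_sq_cinner cinner_simps)

lemma norm_sq_add_orthogonal:
  "cinner x y = 0 \<Longrightarrow> (norm (x + y))\<^sup>2 = (norm x)\<^sup>2 + (norm y)\<^sup>2"
  by (simp add: norm_sq_add)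

lemma norm_cscale: "norm (cscale a x) = cmod a * norm x"
proof -
  have "complex_of_real ((norm (cscale a x))\<^sup>2) = (a * cnj a) * cinner x x"
    by (simp add: cinner_self[symmetric] cinner_cscale_left cinner_cscale_right del: of_real_power)
  also have "\<dots> = complex_of_real ((cmod a * norm x)\<^sup>2)"
    by (simp add: complex_norm_square[symmetric] cinner_self power_mult_distrib)
  finally show ?thesis
    by (simp only: of_real_eq_iff) (simp add: power2_eq_iff_nonneg)
qed

lemma Re_cinner_le: "Re (cinner x y) \<le> norm x * norm y"
proof (cases "x = 0 \<or> y = 0")
  case False
  define u where "u = norm x"
  define v where "v = norm y"
  have pos: "u > 0" "v > 0" using False by (auto simp: u_def v_def)
  have "0 \<le> (norm (v *\<^sub>R x - u *\<^sub>R y))\<^sup>2" by simp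
  also have "\<dots> = 2 * (u * v) * (u * v - Re (cinner x y))"
    unfolding norm_sq_diff using pos
    by (simp add: cinner_simps u_def[symmetric] v_def[symmetric]) (simp add: power2_eq_square algebra_simps)
  finally have "0 \<le> u * v - Re (cinner x y)"
    using pos mult_pos_pos[OF pos] by (simp add: zero_le_mult_iff)
  then show ?thesis by (simp add: u_def v_def)
qed auto

lemma cinner_le_norm: "cmod (cinner x y) \<le> norm x * norm y"
proof -
  \<comment> \<open>Rotating \<open>x\<close> by the phase makes the inner product real. Since
    \<open>sgn 0\<close> is 0, the zero case takes phase 1 to keep
    \<open>cmod a = 1\<close>.\<close>
  define a where "a = (if cinner x y = 0 then 1 else sgn (cinner x y))"
  have a: "cmod a = 1" by (simp add: a_def norm_sgn)
  have "cnj a * cinner x y = complex_of_real (cmod (cinner x y))"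
    using complex_norm_square[of "cinner x y"]
    by (cases "cinner x y = 0")
      (simp_all add: a_def sgn_eq power2_eq_square mult.commute divide_eq_eq)
  then have "cmod (cinner x y) = Re (cinner (cscale a x) y)"
    by (simp add: cinner_cscale_left)
  also have "\<dots> \<le> norm x * norm y"
    using Re_cinner_le[of "cscale a x" y] by (simp add: norm_cscale a)
  finally show ?thesis .
qed

lemma bounded_bilinear_cinner: "bounded_bilinear cinner"
  by unfold_locales
    (auto simp: cinner_simps intro!: exI[of _ 1] cinner_le_norm)

lemmas tendsto_cinner = bounded_bilinear.tendsto[OF bounded_bilinear_cinner]

lemma cscale_zero_right [simp]: "cscale a 0 = 0"
  using norm_cscale[of a 0] by simp

lemma cscale_minus_one: "cscale (-1) x = - x"
  using scaleR_cscale[of "-1" x] by simp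

lemma cscale_diff_right: "cscale a (x - y) = cscale a x - cscale a y"
  using cscale_add_right[of a "x - y" y] by (simp add: algebra_simps)

lemma bounded_linear_cscale: "bounded_linear (cscale a)"
  by (rule bounded_linear_intro[where K = "cmod a"])
    (simp_all add: cscale_add_right norm_cscale scaleR_cscale cscale_cscale mult.commute)

lemmas tendsto_cscale = bounded_linear.tendsto[OF bounded_linear_cscale]

section \<open>Closed subspaces and orthogonal projection\<close>

definition csubspace :: "'a::complex_hilbert set \<Rightarrow> bool" where
  "csubspace K \<longleftrightarrow> 0 \<in> K \<and> (\<forall>x\<in>K. \<forall>y\<in>K. x + y \<in> K) \<and> (\<forall>c. \<forall>x\<in>K. cscale c x \<in> K)"

lemma csubspaceD:
  assumes "csubspace K"
  shows "0 \<in> K" "\<And>x y. x \<in> K \<Longrightarrow> y \<in> K \<Longrightarrow> x + y \<in> K" "\<And>c x. x \<in> K \<Longrightarrow> cscale c x \<in> K"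
    "\<And>r x. x \<in> K \<Longrightarrow> r *\<^sub>R x \<in> K" "\<And>x y. x \<in> K \<Longrightarrow> y \<in> K \<Longrightarrow> x - y \<in> K"
proof -
  show 1: "0 \<in> K" "\<And>x y. x \<in> K \<Longrightarrow> y \<in> K \<Longrightarrow> x + y \<in> K"
      "\<And>c x. x \<in> K \<Longrightarrow> cscale c x \<in> K"
    using assms by (auto simp: csubspace_def)
  then show "\<And>r x. x \<in> K \<Longrightarrow> r *\<^sub>R x \<in> K" by (simp add: scaleR_cscale)
  show "x - y \<in> K" if "x \<in> K" "y \<in> K" for x y
    using 1(2)[OF that(1) 1(3)[OF that(2), of "-1"]] by (simp add: cscale_minus_one)
qed

definition orth :: "'a::complex_hilbert set \<Rightarrow> 'a set" where
  "orth K = {y. \<forall>x\<in>K. cinner x y = 0}"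

lemma csubspace_orth: "csubspace (orth K)"
  by (auto simp: csubspace_def orth_def cinner_add_right cinner_cscale_right)

lemma closed_orth: "closed (orth K)"
  unfolding closed_sequential_limits
proof (intro allI impI, elim conjE)
  fix f :: "nat \<Rightarrow> 'a" and l assume f: "\<forall>n. f n \<in> orth K" and lim: "f \<longlonglongrightarrow> l"
  have "cinner x l = 0" if "x \<in> K" for x
  proof -
    have "(\<lambda>n. cinner x (f n)) \<longlonglongrightarrow> cinner x l" by (intro tendsto_cinner tendsto_const lim)
    moreover have "(\<lambda>n. cinner x (f n)) = (\<lambda>n. 0)" using f that by (auto simp: orth_def)
    ultimately show ?thesis by (simp add: LIMSEQ_const_iff)
  qed
  then show "l \<in> orth K" by (simp add: orth_def)
qed

text \<open>Parallelogram law for \<open>x - y m\<close> and \<open>x - y n\<close>: their midpoint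
  still has squared norm at least \<open>d\<close>, so two near-minimizers must be close to each
  other.\<close>

lemma minimizing_Cauchy:
  fixes y :: "nat \<Rightarrow> 'a::complex_hilbert"
  assumes conv: "\<And>m n. (1/2) *\<^sub>R (y m + y n) \<in> K"
    and lower: "\<And>k. k \<in> K \<Longrightarrow> d \<le> (norm (x - k))\<^sup>2"
    and lim: "(\<lambda>n. (norm (x - y n))\<^sup>2) \<longlonglongrightarrow> d"
  shows "Cauchy y"
proof (rule metric_CauchyI)
  fix e :: real assume "e > 0"
  have "\<forall>\<^sub>F n in sequentially. (norm (x - y n))\<^sup>2 < d + e\<^sup>2 / 4"
    using order_tendstoD(2)[OF lim] \<open>e > 0\<close> by simp
  then obtain N where N: "\<And>n. n \<ge> N \<Longrightarrow> (norm (x - y n))\<^sup>2 < d + e\<^sup>2 / 4"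
    by (auto simp: eventually_sequentially)
  have "dist (y m) (y n) < e" if "m \<ge> N" "n \<ge> N" for m n
  proof -
    have eq: "x - (1/2) *\<^sub>R (y m + y n) = (1/2) *\<^sub>R ((x - y m) + (x - y n))"
      by (simp add: algebra_simps flip: scaleR_add_left)
    have "d \<le> (1/4) * (norm ((x - y m) + (x - y n)))\<^sup>2"
      using lower[OF conv[of m n]] unfolding eq by (simp add: power_mult_distrib power2_eq_square)
    moreover have "(norm ((x - y m) + (x - y n)))\<^sup>2 + (norm (y m - y n))\<^sup>2
        = 2 * (norm (x - y m))\<^sup>2 + 2 * (norm (x - y n))\<^sup>2"
      using norm_sq_diff[of "x - y n" "x - y m"] Re_cinner_commute[of "x - y n" "x - y m"]
      by (simp add: norm_sq_add)
    ultimately have "(norm (y m - y n))\<^sup>2 < e\<^sup>2" using N[OF that(1)] N[OF that(2)] by linarith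
    then show ?thesis using \<open>e > 0\<close> by (simp add: dist_norm power2_less_imp_less)
  qed
  then show "\<exists>M. \<forall>m\<ge>M. \<forall>n\<ge>M. dist (y m) (y n) < e" by blast
qed

lemma projection_exists:
  assumes K: "csubspace K" "closed K"
  obtains k where "k \<in> K" "x - k \<in> orth K"
proof -
  define d where "d = (INF k\<in>K. (norm (x - k))\<^sup>2)"
  have bdd: "bdd_below ((\<lambda>k. (norm (x - k))\<^sup>2) ` K)" by (intro bdd_belowI[of _ 0]) auto
  have ne: "K \<noteq> {}" using csubspaceD(1)[OF K(1)] by auto
  have lower: "d \<le> (norm (x - k))\<^sup>2" if "k \<in> K" for k
    unfolding d_def by (rule cINF_lower[OF bdd that])
  have "\<exists>k\<in>K. (norm (x - k))\<^sup>2 < d + 1 / real (Suc n)" for n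
    using cINF_less_iff[OF ne bdd, of "d + 1 / real (Suc n)"] by (simp add: d_def)
  then obtain y where y: "\<And>n. y n \<in> K" "\<And>n. (norm (x - y n))\<^sup>2 < d + 1 / real (Suc n)"
    by metis
  have lim: "(\<lambda>n. (norm (x - y n))\<^sup>2) \<longlonglongrightarrow> d"
  proof (rule tendsto_sandwich[of "\<lambda>n. d" _ _ "\<lambda>n. d + 1 / real (Suc n)"])
    show "(\<lambda>n. d + 1 / real (Suc n)) \<longlonglongrightarrow> d"
      using tendsto_add[OF tendsto_const LIMSEQ_inverse_real_of_nat, of d]
      by (simp add: inverse_eq_divide)
  qed (use y lower in \<open>auto intro!: always_eventually less_imp_le\<close>)
  have "(1/2) *\<^sub>R (y m + y n) \<in> K" for m n
    by (intro csubspaceD(2,4)[OF K(1)] y(1))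
  then have "Cauchy y" by (rule minimizing_Cauchy[OF _ lower lim])
  then obtain k where k: "y \<longlonglongrightarrow> k" by (auto simp: Cauchy_convergent_iff convergent_def)
  have kK: "k \<in> K" using K(2) y(1) k by (metis closed_sequentially)
  have "(\<lambda>n. (norm (x - y n))\<^sup>2) \<longlonglongrightarrow> (norm (x - k))\<^sup>2" by (intro tendsto_intros k)
  with lim have dk: "d = (norm (x - k))\<^sup>2" by (rule LIMSEQ_unique)
  have "cinner z (x - k) = 0" if z: "z \<in> K" for z
  proof (cases "z = 0")
    case False
    \<comment> \<open>\<open>cscale a z\<close> is the component of \<open>x - k\<close> along
      \<open>z\<close>. Comparing \<open>k\<close> with \<open>k + cscale a z\<close>, minimality
      gives 2 |az|^2 <= |az|^2, hence \<open>a = 0\<close>.\<close>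
    define a where "a = cinner z (x - k) / complex_of_real ((norm z)\<^sup>2)"
    have "k + cscale a z \<in> K" using K(1) kK z by (simp add: csubspaceD)
    from lower[OF this] have "(norm (x - k))\<^sup>2 \<le> (norm ((x - k) - cscale a z))\<^sup>2"
      by (simp add: dk algebra_simps)
    then have "2 * Re (cinner (x - k) (cscale a z)) \<le> (cmod a * norm z)\<^sup>2"
      by (simp add: norm_sq_diff norm_cscale)
    moreover have "cinner (x - k) (cscale a z) = complex_of_real ((cmod a * norm z)\<^sup>2)"
    proof -
      have "cinner (x - k) z = cnj a * complex_of_real ((norm z)\<^sup>2)"
        using False cinner_commute[of "x - k" z] by (simp add: a_def)
      then show ?thesis using complex_norm_square[of a]
        by (simp add: cinner_cscale_right power_mult_distrib)
    qed
    ultimately have "(cmod a * norm z)\<^sup>2 \<le> 0" by simp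
    then have "a = 0" using False by simp
    then show ?thesis using False by (simp add: a_def)
  qed simp
  then have "x - k \<in> orth K" by (simp add: orth_def)
  with kK show ?thesis by (rule that)
qed

lemma orth_orth:
  assumes K: "csubspace K" "closed K" and x: "x \<in> orth (orth K)"
  shows "x \<in> K"
proof -
  obtain k where k: "k \<in> K" "x - k \<in> orth K" by (rule projection_exists[OF K])
  have "cinner (x - k) x = 0" using x k(2) by (simp add: orth_def)
  moreover have "cinner (x - k) k = 0" using k cinner_eq_zero_commute by (auto simp: orth_def)
  ultimately have "cinner (x - k) (x - k) = 0" by (simp add: cinner_diff_right)
  then show ?thesis using k(1) by simp
qed

definition proj :: "'a::complex_hilbert set \<Rightarrow> 'a \<Rightarrow> 'a" where
  "proj K x = (SOME k. k \<in> K \<and> x - k \<in> orth K)"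

lemma proj_props:
  assumes K: "csubspace K" "closed K"
  shows proj_in: "proj K x \<in> K" and proj_diff: "x - proj K x \<in> orth K"
proof -
  have "\<exists>k. k \<in> K \<and> x - k \<in> orth K" using projection_exists[OF K] by metis
  from someI_ex[OF this] show "proj K x \<in> K" "x - proj K x \<in> orth K"
    by (auto simp: proj_def)
qed

lemma proj_unique:
  assumes K: "csubspace K" "closed K" and k: "k \<in> K" "x - k \<in> orth K"
  shows "proj K x = k"
proof -
  have "proj K x - k \<in> K" using proj_in[OF K] k(1) csubspaceD(5)[OF K(1)] by blast
  moreover have "(x - k) - (x - proj K x) \<in> orth K"
    using proj_diff[OF K] k(2) csubspaceD(5)[OF csubspace_orth] by blast
  ultimately have "cinner (proj K x - k) (proj K x - k) = 0" by (simp add: orth_def)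
  then show ?thesis by simp
qed

section \<open>Bounded operators and adjoints\<close>

lemma bounded_opD:
  assumes "bounded_op T"
  shows "bounded_linear T" "\<And>x y. T (x + y) = T x + T y" "\<And>x y. T (x - y) = T x - T y"
    "\<And>c x. T (cscale c x) = cscale c (T x)" "\<And>r x. T (r *\<^sub>R x) = r *\<^sub>R T x" "T 0 = 0"
    "\<And>x. T (- x) = - T x"
  using assms
  by (auto simp: bounded_op_def bounded_linear.linear linear_add linear_diff linear_scale
      linear_0 linear_neg)

lemma bounded_opI:
  assumes "\<And>x y. T (x + y) = T x + T y" "\<And>c x. T (cscale c x) = cscale c (T x)"
    "\<And>x. norm (T x) \<le> k * norm x"
  shows "bounded_op T"
  unfolding bounded_op_def
  by (auto intro!: bounded_linear_intro[of T k] simp: assms scaleR_cscale mult.commute[of _ k])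

lemma bounded_op_bound:
  assumes "bounded_op T"
  obtains k where "k > 0" "\<And>x. norm (T x) \<le> k * norm x"
  using bounded_linear.pos_bounded[OF bounded_opD(1)[OF assms]] by (metis mult.commute)

lemma bounded_op_id [simp]: "bounded_op id"
  by (rule bounded_opI[of _ 1]) auto

lemma bounded_op_compose:
  assumes "bounded_op S" "bounded_op T"
  shows "bounded_op (\<lambda>x. S (T x))"
  using assms bounded_linear_compose[of S T] by (auto simp: bounded_op_def)

lemma bounded_op_add:
  assumes "bounded_op S" "bounded_op T"
  shows "bounded_op (\<lambda>x. S x + T x)"
  using assms bounded_linear_add[of S T] by (auto simp: bounded_op_def cscale_add_right)

lemma bounded_op_diff:
  assumes "bounded_op S" "bounded_op T"
  shows "bounded_op (\<lambda>x. S x - T x)"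
  using assms bounded_linear_sub[of S T] by (auto simp: bounded_op_def cscale_diff_right)

lemma bounded_op_cscale: "bounded_op S \<Longrightarrow> bounded_op (\<lambda>x. cscale c (S x))"
  using bounded_linear_compose[OF bounded_linear_cscale, of S]
  by (auto simp: bounded_op_def cscale_cscale mult.commute)

lemma bounded_op_scaleR: "bounded_op S \<Longrightarrow> bounded_op (\<lambda>x. r *\<^sub>R S x)"
  using bounded_op_cscale[of S "complex_of_real r"] by (simp add: scaleR_cscale)

lemma Riesz_representation:
  fixes f :: "'a::complex_hilbert \<Rightarrow> complex"
  assumes f: "bounded_linear f" "\<And>c x. f (cscale c x) = c * f x"
  obtains y where "\<And>x. f x = cinner y x"
proof (cases "\<forall>x. f x = 0")
  case True
  then show ?thesis using that[of 0] by simp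
next
  case False
  then obtain v where v: "f v \<noteq> 0" by blast
  note lin = bounded_linear.linear[OF f(1)]
  define K where "K = {x. f x = 0}"
  have K: "csubspace K"
    by (auto simp: K_def csubspace_def f(2) linear_add[OF lin] linear_0[OF lin])
  have "closed K" unfolding K_def
    by (intro closed_Collect_eq continuous_intros linear_continuous_on f(1))
  with K obtain k where k: "k \<in> K" "v - k \<in> orth K" by (rule projection_exists)
  define u where "u = v - k"
  have fu: "f u \<noteq> 0" using v k(1) by (simp add: u_def K_def linear_diff[OF lin])
  then have u0: "u \<noteq> 0" using linear_0[OF lin] by auto
  have "f x = cinner (cscale (cnj (f u) / complex_of_real ((norm u)\<^sup>2)) u) x" for x
  proof -
    have "x - cscale (f x / f u) u \<in> K"
      using fu by (simp add: K_def linear_diff[OF lin] f(2))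
    then have "cinner u (x - cscale (f x / f u) u) = 0"
      using k(2) cinner_eq_zero_commute by (auto simp: u_def orth_def)
    then have "cinner u x = f x / f u * complex_of_real ((norm u)\<^sup>2)"
      by (simp add: cinner_diff_right cinner_cscale_right cinner_self)
    then show ?thesis using fu u0 by (simp add: cinner_cscale_left field_simps)
  qed
  then show ?thesis by (rule that)
qed

text \<open>\<open>adjoint\<close> is defined by choice, so its defining equation needs a witness;
  Riesz representation of the functionals \<open>cinner y (T x)\<close> in \<open>x\<close> supplies
  it.\<close>

lemma adjoint:
  assumes T: "bounded_op T"
  shows "cinner (T x) y = cinner x (adjoint T y)"
proof -
  have "\<exists>z. \<forall>x. cinner y (T x) = cinner z x" for y
  proof -
    have "bounded_linear (\<lambda>x. cinner y (T x))"
      by (rule bounded_linear_compose[OF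
            bounded_bilinear.bounded_linear_right[OF bounded_bilinear_cinner] bounded_opD(1)[OF T]])
    then show ?thesis
      by (rule Riesz_representation) (auto simp: bounded_opD[OF T] cinner_cscale_right)
  qed
  then obtain S where "\<And>y x. cinner y (T x) = cinner (S y) x" by metis
  then have "\<exists>S. \<forall>x y. cinner (T x) y = cinner x (S y)"
    by (metis cinner_commute)
  from someI_ex[OF this] show ?thesis unfolding adjoint_def by blast
qed

lemma adjoint': "bounded_op T \<Longrightarrow> cinner x (T y) = cinner (adjoint T x) y"
  by (metis adjoint cinner_commute)

lemma adjoint_unique:
  assumes "bounded_op T" "\<And>x y. cinner (T x) y = cinner x (S y)"
  shows "adjoint T = S"
  using assms by (intro ext cinner_eqI) (simp add: adjoint[symmetric])

lemma bounded_op_adjoint: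
  assumes T: "bounded_op T"
  shows "bounded_op (adjoint T)"
proof -
  obtain k where k: "k > 0" "\<And>x. norm (T x) \<le> k * norm x" using bounded_op_bound[OF T] by metis
  show ?thesis
  proof (rule bounded_opI[of _ k])
    show "adjoint T (x + y) = adjoint T x + adjoint T y" for x y
      by (rule cinner_eqI) (simp add: adjoint[OF T, symmetric] cinner_add_right)
    show "adjoint T (cscale c x) = cscale c (adjoint T x)" for c x
      by (rule cinner_eqI) (simp add: adjoint[OF T, symmetric] cinner_cscale_right)
    fix x
    have "(norm (adjoint T x))\<^sup>2 = Re (cinner (T (adjoint T x)) x)"
      by (simp add: norm_sq_cinner adjoint[OF T])
    also have "\<dots> \<le> norm (T (adjoint T x)) * norm x" by (rule Re_cinner_le)
    also have "\<dots> \<le> k * norm (adjoint T x) * norm x" by (intro mult_right_mono k) auto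
    finally show "norm (adjoint T x) \<le> k * norm x"
      by (cases "adjoint T x = 0") (use k(1) in \<open>auto simp: power2_eq_square\<close>)
  qed
qed

text \<open>Polarization: norms determine the real part of the inner product, and replacing
  \<open>x\<close> by \<open>cscale \<i> x\<close> recovers the imaginary part.\<close>

lemma isometry_cinner:
  assumes V: "bounded_op V" and iso: "\<And>x. norm (V x) = norm x"
  shows "cinner (V x) (V y) = cinner x y"
proof -
  have re: "Re (cinner (V x) (V y)) = Re (cinner x y)" for x y
    using norm_sq_add[of "V x" "V y"] norm_sq_add[of x y]
    by (simp add: iso flip: bounded_opD(2)[OF V])
  have "Im (cinner u v) = Re (cinner (cscale \<i> u) v)" for u v :: 'a
    by (simp add: cinner_cscale_left)
  then have "Im (cinner (V x) (V y)) = Im (cinner x y)"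
    using re[of "cscale \<i> x" y] by (simp add: bounded_opD(4)[OF V])
  with re show ?thesis by (simp add: complex_eq_iff)
qed

lemma isometry_adjoint:
  assumes "bounded_op V" "\<And>x. norm (V x) = norm x"
  shows "adjoint V \<circ> V = id"
  by (intro ext cinner_eqI) (simp add: adjoint[OF assms(1), symmetric] isometry_cinner[OF assms])

section \<open>Square roots and polar decomposition\<close>

text \<open>The fixed point \<open>B\<close> of \<open>B = (A + B\<^sup>2) / 2\<close> satisfies \<open>(1 - B)\<^sup>2 = 1 - A\<close>. The iteration
  is controlled by the same iteration for the scalar \<open>A = 1\<close>.\<close>

primrec op_iter :: "('a::complex_hilbert \<Rightarrow> 'a) \<Rightarrow> nat \<Rightarrow> 'a \<Rightarrow> 'a" where
  "op_iter A 0 = (\<lambda>x. 0)"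
| "op_iter A (Suc n) = (\<lambda>x. (1/2) *\<^sub>R (A x + op_iter A n (op_iter A n x)))"

primrec real_iter :: "nat \<Rightarrow> real" where
  "real_iter 0 = 0"
| "real_iter (Suc n) = (1 + (real_iter n)\<^sup>2) / 2"

text \<open>Monotone and bounded, this sequence converges; its increments will majorize those of
  \<open>op_iter\<close>.\<close>

lemma real_iter_bounds: "0 \<le> real_iter n \<and> real_iter n \<le> 1 \<and> real_iter n \<le> real_iter (Suc n)"
proof (induction n)
  case (Suc n)
  then have "(real_iter n)\<^sup>2 \<le> (real_iter (Suc n))\<^sup>2" "(real_iter n)\<^sup>2 \<le> 1"
    by (auto intro!: power_mono power_le_one simp del: real_iter.simps)
  then show ?case by (simp add: real_iter.simps(2)[of "Suc n"] del: real_iter.simps(2)) simp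
qed simp

lemma real_iter_incseq: "incseq real_iter"
  using real_iter_bounds by (intro incseq_SucI) auto

lemma op_iter_bounded_op:
  assumes A: "bounded_op A"
  shows "bounded_op (op_iter A n)"
proof (induction n)
  case 0
  show ?case by (auto intro!: bounded_opI[of _ 0])
next
  case (Suc n)
  then show ?case
    unfolding op_iter.simps by (intro bounded_op_scaleR bounded_op_add A bounded_op_compose[OF Suc Suc])
qed

lemma op_iter_norm:
  assumes nA: "\<And>x. norm (A x) \<le> norm x"
  shows "norm (op_iter A n x) \<le> real_iter n * norm x"
proof (induction n arbitrary: x)
  case (Suc n)
  have "norm (op_iter A n (op_iter A n x)) \<le> real_iter n * norm (op_iter A n x)" by (rule Suc)
  also have "\<dots> \<le> real_iter n * (real_iter n * norm x)"
    using real_iter_bounds[of n] by (intro mult_left_mono Suc) auto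
  finally have "norm (A x + op_iter A n (op_iter A n x)) \<le> norm x + (real_iter n)\<^sup>2 * norm x"
    by (intro norm_triangle_mono nA) (simp add: power2_eq_square mult.assoc)
  then show ?case by (simp add: algebra_simps del: scaleR_add_right)
qed simp

lemma op_iter_step:
  assumes A: "bounded_op A" and nA: "\<And>x. norm (A x) \<le> norm x"
  shows "norm (op_iter A (Suc n) x - op_iter A n x) \<le> (real_iter (Suc n) - real_iter n) * norm x"
proof (induction n arbitrary: x)
  case 0
  then show ?case using nA[of x] by simp
next
  case (Suc n)
  define B where "B = op_iter A n"
  define C where "C = op_iter A (Suc n)"
  define b where "b = real_iter n"
  define c where "c = real_iter (Suc n)"
  have bc: "0 \<le> b" "b \<le> c" using real_iter_bounds[of n] by (auto simp: b_def c_def)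
  have C: "C (u - v) = C u - C v" for u v
    unfolding C_def by (rule bounded_opD(3)[OF op_iter_bounded_op[OF A]])
  have nC: "norm (C u) \<le> c * norm u" and nB: "norm (B u) \<le> b * norm u" for u
    unfolding B_def C_def b_def c_def by (rule op_iter_norm[OF nA])+
  have IH: "norm (C u - B u) \<le> (c - b) * norm u" for u
    unfolding B_def C_def b_def c_def by (rule Suc)
  have "op_iter A (Suc (Suc n)) x - op_iter A (Suc n) x = (1/2) *\<^sub>R (A x + C (C x)) - (1/2) *\<^sub>R (A x + B (B x))"
    by (simp add: B_def C_def)
  \<comment> \<open>The splitting C^2 - B^2 = C (C - B) + (C - B) B needs no commutation, and its
    scalar counterpart c (c - b) + (c - b) b is exactly c^2 - b^2, so the majorant reproduces
    itself.\<close>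
  also have "\<dots> = (1/2) *\<^sub>R (C (C x - B x) + (C (B x) - B (B x)))"
    by (simp add: C algebra_simps)
  finally have eq: "op_iter A (Suc (Suc n)) x - op_iter A (Suc n) x = \<dots>" .
  have "norm (C (C x - B x)) \<le> c * ((c - b) * norm x)"
    using bc by (intro order_trans[OF nC] mult_left_mono IH) auto
  moreover have "norm (C (B x) - B (B x)) \<le> (c - b) * (b * norm x)"
    using bc by (intro order_trans[OF IH] mult_left_mono nB) auto
  ultimately have "norm (C (C x - B x) + (C (B x) - B (B x))) \<le> (c\<^sup>2 - b\<^sup>2) * norm x"
    by (intro order_trans[OF norm_triangle_ineq]) (simp add: algebra_simps power2_eq_square)
  moreover have "real_iter (Suc (Suc n)) - real_iter (Suc n) = (c\<^sup>2 - b\<^sup>2) / 2"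
    by (simp add: b_def c_def field_simps)
  ultimately show ?case unfolding eq
    by (simp only: norm_scaleR times_divide_eq_left)
qed

lemma op_iter_dist:
  assumes A: "bounded_op A" and nA: "\<And>x. norm (A x) \<le> norm x" and "n \<le> m"
  shows "norm (op_iter A m x - op_iter A n x) \<le> (real_iter m - real_iter n) * norm x"
  using \<open>n \<le> m\<close>
proof (induction rule: dec_induct)
  case (step m)
  have "norm (op_iter A (Suc m) x - op_iter A n x)
      \<le> norm (op_iter A (Suc m) x - op_iter A m x) + norm (op_iter A m x - op_iter A n x)"
    using norm_triangle_ineq[of "op_iter A (Suc m) x - op_iter A m x" "op_iter A m x - op_iter A n x"]
    by (simp del: op_iter.simps)
  also have "\<dots> \<le> (real_iter (Suc m) - real_iter n) * norm x"
    using op_iter_step[OF A nA, of m x] step.IH by (simp add: algebra_simps del: op_iter.simps real_iter.simps)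
  finally show ?case .
qed simp

lemma op_iter_selfadjoint:
  assumes sA: "\<And>x y. cinner (A x) y = cinner x (A y)"
  shows "cinner (op_iter A n x) y = cinner x (op_iter A n y)"
  by (induction n arbitrary: x y) (simp_all add: cinner_simps sA)

lemma op_iter_commute:
  assumes R: "bounded_op R" and RA: "\<And>x. R (A x) = A (R x)"
  shows "R (op_iter A n x) = op_iter A n (R x)"
  by (induction n arbitrary: x) (simp_all add: bounded_opD[OF R] RA)

lemma op_iter_limit:
  assumes A: "bounded_op A" and nA: "\<And>x. norm (A x) \<le> norm x"
    and sA: "\<And>x y. cinner (A x) y = cinner x (A y)"
  obtains B where "bounded_op B" "\<And>x. norm (B x) \<le> norm x"
    "\<And>x y. cinner (B x) y = cinner x (B y)" "\<And>x. 2 *\<^sub>R B x = A x + B (B x)"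
    "\<forall>R. bounded_op R \<longrightarrow> (\<forall>x. R (A x) = A (R x)) \<longrightarrow> (\<forall>x. R (B x) = B (R x))"
proof -
  let ?B = "op_iter A"
  have "convergent real_iter"
    using real_iter_bounds
    by (intro Bseq_monoseq_convergent BseqI'[where K = 1] incseq_imp_monoseq real_iter_incseq) auto
  then have cb: "Cauchy real_iter" by (simp add: Cauchy_convergent_iff)
  have "Cauchy (\<lambda>n. ?B n x)" for x
  proof (rule metric_CauchyI)
    fix e :: real assume "e > 0"
    define k where "k = norm x + 1"
    have k: "k > 0" by (simp add: k_def add_nonneg_pos)
    obtain N where N: "\<And>m n. m \<ge> N \<Longrightarrow> n \<ge> N \<Longrightarrow> dist (real_iter m) (real_iter n) < e / k"
      using metric_CauchyD[OF cb, of "e / k"] \<open>e > 0\<close> k by auto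
    have *: "dist (?B m x) (?B n x) < e" if "m \<ge> n" "n \<ge> N" for m n
    proof -
      have "dist (?B m x) (?B n x) \<le> (real_iter m - real_iter n) * norm x"
        using op_iter_dist[OF A nA that(1), of x] by (simp add: dist_norm)
      also have "\<dots> \<le> (real_iter m - real_iter n) * k"
        using incseqD[OF real_iter_incseq that(1)] by (intro mult_left_mono) (auto simp: k_def)
      also have "\<dots> < e / k * k"
        using N[of m n] that k by (intro mult_strict_right_mono) (auto simp: dist_real_def)
      finally show ?thesis using k by simp
    qed
    have "dist (?B m x) (?B n x) < e" if "m \<ge> N" "n \<ge> N" for m n
      using *[of n m] *[of m n] that by (cases "n \<le> m") (auto simp: dist_commute)
    then show "\<exists>M. \<forall>m\<ge>M. \<forall>n\<ge>M. dist (?B m x) (?B n x) < e" by blast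
  qed
  then have "\<forall>x. \<exists>l. (\<lambda>n. ?B n x) \<longlonglongrightarrow> l" by (auto simp: Cauchy_convergent_iff convergent_def)
  then obtain B where lim: "\<And>x. (\<lambda>n. ?B n x) \<longlonglongrightarrow> B x" by metis
  have nBn: "norm (?B n x) \<le> norm x" for n x
    using op_iter_norm[OF nA, of n x] real_iter_bounds[of n] mult_right_mono[of "real_iter n" 1 "norm x"]
    by auto
  note Bn = bounded_opD[OF op_iter_bounded_op[OF A]]
  show ?thesis
  proof (rule that[of B])
    show nB: "norm (B x) \<le> norm x" for x
      by (rule LIMSEQ_le_const2[OF tendsto_norm[OF lim]]) (use nBn in auto)
    show bB: "bounded_op B"
    proof (rule bounded_opI[of _ 1])
      show "B (x + y) = B x + B y" for x y
        using lim[of "x + y"] tendsto_add[OF lim[of x] lim[of y]] unfolding Bn(2) by (rule LIMSEQ_unique)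
      show "B (cscale c x) = cscale c (B x)" for c x
        using lim[of "cscale c x"] tendsto_cscale[OF lim[of x]] unfolding Bn(4) by (rule LIMSEQ_unique)
    qed (simp add: nB)
    show "cinner (B x) y = cinner x (B y)" for x y
      using tendsto_cinner[OF lim tendsto_const, of x y] tendsto_cinner[OF tendsto_const lim, of x y]
      unfolding op_iter_selfadjoint[OF sA] by (rule LIMSEQ_unique)
    show "\<forall>R. bounded_op R \<longrightarrow> (\<forall>x. R (A x) = A (R x)) \<longrightarrow> (\<forall>x. R (B x) = B (R x))"
    proof (intro allI impI)
      fix R x assume R: "bounded_op R" and c: "\<forall>x. R (A x) = A (R x)"
      have "R (?B n x) = ?B n (R x)" for n by (rule op_iter_commute[OF R]) (simp add: c)
      then show "R (B x) = B (R x)"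
        using bounded_linear.tendsto[OF bounded_opD(1)[OF R] lim[of x]] lim[of "R x"]
        by (simp add: LIMSEQ_unique)
    qed
    show "2 *\<^sub>R B x = A x + B (B x)" for x
    proof -
      \<comment> \<open>Pointwise convergence passes to the square because the iterates are
        uniformly contractive: \<open>?B n\<close> applied to \<open>?B n x - B x\<close> has norm
        at most that of its argument.\<close>
      have "(\<lambda>n. ?B n (?B n x)) \<longlonglongrightarrow> B (B x)"
      proof (rule Lim_transform)
        show "(\<lambda>n. ?B n (B x)) \<longlonglongrightarrow> B (B x)" by (rule lim)
        have "(\<lambda>n. ?B n x - B x) \<longlonglongrightarrow> 0" using LIM_zero[OF lim[of x]] .
        then show "(\<lambda>n. ?B n (?B n x) - ?B n (B x)) \<longlonglongrightarrow> 0"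
          by (rule Lim_null_comparison[rotated, OF tendsto_norm_zero])
            (auto simp flip: Bn(3) intro!: always_eventually nBn)
      qed
      then have "(\<lambda>n. 2 *\<^sub>R ?B (Suc n) x) \<longlonglongrightarrow> A x + B (B x)"
        by (simp add: tendsto_intros)
      moreover have "(\<lambda>n. 2 *\<^sub>R ?B (Suc n) x) \<longlonglongrightarrow> 2 *\<^sub>R B x"
        by (intro tendsto_intros LIMSEQ_Suc lim)
      ultimately show ?thesis by (rule LIMSEQ_unique[rotated])
    qed
  qed
qed

text \<open>The positive square root of the adjoint of \<open>S\<close> times \<open>S\<close>.
  Commutation is recorded for every bounded \<open>R\<close>, because it serves twice: for
  \<open>R\<close> in the commutant it puts \<open>H\<close> into the algebra, and for operators of
  the algebra it makes spectral projections commute with \<open>H\<close>.\<close>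

lemma absolute_value_exists:
  assumes S: "bounded_op S"
  obtains H where "bounded_op H" "\<And>x y. cinner (H x) y = cinner x (H y)"
    "\<And>x. 0 \<le> Re (cinner x (H x))" "\<And>x. H (H x) = adjoint S (S x)" "\<And>x. norm (H x) = norm (S x)"
    "\<forall>R. bounded_op R \<longrightarrow> (\<forall>x. R (adjoint S (S x)) = adjoint S (S (R x))) \<longrightarrow>
      (\<forall>x. R (H x) = H (R x))"
proof -
  obtain k where k: "k > 0" and kb: "\<And>x. norm (S x) \<le> k * norm x" using bounded_op_bound[OF S] by metis
  let ?D = "\<lambda>x. adjoint S (S x)"
  have D: "bounded_op ?D" by (rule bounded_op_compose[OF bounded_op_adjoint[OF S] S])
  \<comment> \<open>Dividing by the square of the bound \<open>k\<close> makes \<open>A\<close> a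
    contraction, as the iteration requires. From (1 - B)^2 = 1 - A it follows that k (1 - B) squares
    to \<open>?D\<close>.\<close>
  define A where "A = (\<lambda>x. x - (1/k\<^sup>2) *\<^sub>R ?D x)"
  have A: "bounded_op A" unfolding A_def
    by (intro bounded_op_diff bounded_op_scaleR D) (use bounded_op_id in \<open>simp add: id_def\<close>)
  have DS: "cinner x (?D y) = cinner (S x) (S y)" for x y by (simp add: adjoint[OF S])
  have SD: "cinner (?D x) y = cinner (S x) (S y)" for x y by (simp add: adjoint'[OF S])
  have sA: "cinner (A x) y = cinner x (A y)" for x y
    by (simp add: A_def cinner_simps SD DS)
  have nA: "norm (A x) \<le> norm x" for x
  proof -
    \<comment> \<open>With this bound the quadratic term |Dx|^2 / k^4 of |Ax|^2 is at most half of
      the cross term 2 |Sx|^2 / k^2 that is subtracted.\<close>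
    have nD: "norm (?D x) \<le> k * norm (S x)"
    proof -
      have "(norm (?D x))\<^sup>2 = Re (cinner (S (?D x)) (S x))" by (simp add: norm_sq_cinner DS)
      also have "\<dots> \<le> (k * norm (?D x)) * norm (S x)"
        by (rule order_trans[OF Re_cinner_le]) (intro mult_right_mono kb norm_ge_zero)
      finally have "norm (?D x) * norm (?D x) \<le> (k * norm (S x)) * norm (?D x)"
        by (simp add: power2_eq_square mult_ac)
      then show ?thesis
        using k by (cases "norm (?D x) = 0") (simp_all add: mult_le_cancel_right)
    qed
    have "(norm (?D x))\<^sup>2 \<le> k\<^sup>2 * (norm (S x))\<^sup>2"
      using power_mono[OF nD, of 2] by (simp add: power_mult_distrib)
    then have "(norm ((1/k\<^sup>2) *\<^sub>R ?D x))\<^sup>2 \<le> (norm (S x))\<^sup>2 / k\<^sup>2"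
      using k by (simp add: power_divide field_simps power2_eq_square)
    moreover have "Re (cinner x ((1/k\<^sup>2) *\<^sub>R ?D x)) = (norm (S x))\<^sup>2 / k\<^sup>2"
      by (simp add: cinner_simps DS norm_sq_cinner)
    ultimately have "(norm (A x))\<^sup>2 \<le> (norm x)\<^sup>2 - (norm (S x))\<^sup>2 / k\<^sup>2"
      by (simp add: A_def norm_sq_diff)
    also have "\<dots> \<le> (norm x)\<^sup>2" by simp
    finally show ?thesis by (rule power2_le_imp_le) simp
  qed
  obtain B where B: "bounded_op B" "\<And>x. norm (B x) \<le> norm x"
    "\<And>x y. cinner (B x) y = cinner x (B y)" "\<And>x. 2 *\<^sub>R B x = A x + B (B x)"
    "\<forall>R. bounded_op R \<longrightarrow> (\<forall>x. R (A x) = A (R x)) \<longrightarrow> (\<forall>x. R (B x) = B (R x))"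
    by (rule op_iter_limit[OF A nA sA]) (rule that; assumption)
  define H where "H = (\<lambda>x. k *\<^sub>R (x - B x))"
  have HH: "H (H x) = ?D x" for x
  proof -
    have "H (H x) = k\<^sup>2 *\<^sub>R (x - 2 *\<^sub>R B x + B (B x))"
      by (simp add: H_def bounded_opD[OF B(1)] algebra_simps power2_eq_square scaleR_2)
    also have "\<dots> = k\<^sup>2 *\<^sub>R (x - A x)" by (simp add: B(4))
    finally show ?thesis using k by (simp add: A_def)
  qed
  have sH: "cinner (H x) y = cinner x (H y)" for x y by (simp add: H_def cinner_simps B(3))
  show ?thesis
  proof (rule that[of H])
    show "bounded_op H" unfolding H_def
      by (intro bounded_op_diff bounded_op_scaleR B(1)) (use bounded_op_id in \<open>simp add: id_def\<close>)
    show "0 \<le> Re (cinner x (H x))" for x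
    proof -
      have "Re (cinner x (B x)) \<le> norm x * norm x"
        by (rule order_trans[OF Re_cinner_le]) (intro mult_left_mono B norm_ge_zero)
      then show ?thesis using k by (simp add: H_def cinner_simps cinner_self power2_eq_square)
    qed
    show "norm (H x) = norm (S x)" for x
    proof -
      have "(norm (H x))\<^sup>2 = (norm (S x))\<^sup>2" by (simp add: norm_sq_cinner sH HH DS)
      then show ?thesis by simp
    qed
    show "\<forall>R. bounded_op R \<longrightarrow> (\<forall>x. R (?D x) = ?D (R x)) \<longrightarrow> (\<forall>x. R (H x) = H (R x))"
    proof (intro allI impI)
      fix R x assume R: "bounded_op R" and c: "\<forall>x. R (?D x) = ?D (R x)"
      have "R (A x) = A (R x)" for x by (simp add: A_def bounded_opD[OF R] c)
      then have "R (B x) = B (R x)" using B(5) R by blast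
      then show "R (H x) = H (R x)" by (simp add: H_def bounded_opD[OF R])
    qed
  qed (rule sH HH)+
qed

section \<open>Extending isometric relations to unitaries\<close>

lemma
  assumes K: "csubspace K" "closed K"
  shows bounded_op_proj: "bounded_op (proj K)"
    and proj_selfadjoint: "cinner (proj K x) y = cinner x (proj K y)"
    and norm_proj_le: "norm (proj K x) \<le> norm x"
    and proj_of_mem: "x \<in> K \<Longrightarrow> proj K x = x"
    and proj_of_orth: "x \<in> orth K \<Longrightarrow> proj K x = 0"
    and norm_sq_proj: "(norm x)\<^sup>2 = (norm (proj K x))\<^sup>2 + (norm (x - proj K x))\<^sup>2"
proof -
  note K1 = csubspaceD[OF K(1)] and O1 = csubspaceD[OF csubspace_orth[of K]]
    and pin = proj_in[OF K] and pd = proj_diff[OF K]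
  have o: "cinner (proj K x) (y - proj K y) = 0" for x y
    using pin pd by (auto simp: orth_def)
  have o': "cinner (y - proj K y) (proj K x) = 0" for x y
    using o[of x y] cinner_eq_zero_commute by blast
  show ns: "(norm x)\<^sup>2 = (norm (proj K x))\<^sup>2 + (norm (x - proj K x))\<^sup>2" for x
    using norm_sq_add_orthogonal[OF o[of x x]] by simp
  have "(norm (proj K x))\<^sup>2 \<le> (norm x)\<^sup>2" for x using ns[of x] by simp
  then show np: "norm (proj K x) \<le> norm x" for x by (rule power2_le_imp_le) simp
  show "bounded_op (proj K)"
  proof (rule bounded_opI[of _ 1])
    show "proj K (x + y) = proj K x + proj K y" for x y
      using O1(2)[OF pd[of x] pd[of y]] by (intro proj_unique[OF K] K1(2) pin) (simp add: algebra_simps)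
    show "proj K (cscale c x) = cscale c (proj K x)" for c x
      using O1(3)[OF pd[of x], of c] by (intro proj_unique[OF K] K1(3) pin) (simp add: cscale_diff_right)
  qed (simp add: np)
  show "cinner (proj K x) y = cinner x (proj K y)" for x y
    using o[of x y] o'[of x y] by (simp add: cinner_simps)
  show "x \<in> K \<Longrightarrow> proj K x = x" by (rule proj_unique[OF K]) (simp_all add: O1)
  show "x \<in> orth K \<Longrightarrow> proj K x = 0" by (rule proj_unique[OF K]) (simp_all add: K1)
qed

section \<open>Von Neumann algebras, their commutants and the projections they contain\<close>

locale vN_algebra =
  fixes M :: "('a::complex_hilbert \<Rightarrow> 'a) set"
  assumes vN: "von_neumann_algebra M"
begin

lemma M_bounded: "T \<in> M \<Longrightarrow> bounded_op T"
  using vN by (simp add: von_neumann_algebra_def)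

lemma M_id: "id \<in> M" "(\<lambda>x. x) \<in> M"
  using vN by (simp_all add: von_neumann_algebra_def id_def)

lemma M_add: "S \<in> M \<Longrightarrow> T \<in> M \<Longrightarrow> (\<lambda>x. S x + T x) \<in> M"
  using vN by (simp add: von_neumann_algebra_def)

lemma M_compose: "S \<in> M \<Longrightarrow> T \<in> M \<Longrightarrow> (\<lambda>x. S (T x)) \<in> M"
  using vN by (simp add: von_neumann_algebra_def o_def)

lemma M_adjoint: "T \<in> M \<Longrightarrow> adjoint T \<in> M"
  using vN by (simp add: von_neumann_algebra_def)

lemma M_scaleR: "T \<in> M \<Longrightarrow> (\<lambda>x. r *\<^sub>R T x) \<in> M"
  using vN by (simp add: von_neumann_algebra_def scaleR_cscale)

lemma M_diff: "S \<in> M \<Longrightarrow> T \<in> M \<Longrightarrow> (\<lambda>x. S x - T x) \<in> M"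
  using M_add[OF _ M_scaleR[of T "-1"], of S] by simp

text \<open>The bicommutant condition as a membership test: this is how limits, projections,
  unitaries and inverses are recognized as elements of \<open>M\<close>.\<close>

lemma M_memI:
  assumes "bounded_op X" "\<And>R x. R \<in> commutant M \<Longrightarrow> X (R x) = R (X x)"
  shows "X \<in> M"
proof -
  have "X \<in> commutant (commutant M)"
    using assms by (auto simp: commutant_def[of "commutant M"] o_def)
  then show ?thesis using vN by (simp add: von_neumann_algebra_def)
qed

lemma commutantD:
  assumes "R \<in> commutant M"
  shows "bounded_op R" "T \<in> M \<Longrightarrow> R (T x) = T (R x)"
  using assms by (auto simp: commutant_def o_def fun_eq_iff)

text \<open>Scalars belong to the commutant, so stability under the commutant already includes
  complex homogeneity. The later closure conditions therefore ask only for sums.\<close>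

lemma commutant_cscale: "cscale c \<in> commutant M"
proof -
  have "bounded_op (cscale c :: 'a \<Rightarrow> 'a)" using bounded_op_cscale[OF bounded_op_id, of c] by simp
  then show ?thesis by (auto simp: commutant_def o_def bounded_opD(4)[OF M_bounded])
qed

lemma commutant_uminus: "uminus \<in> commutant M"
  using commutant_cscale[of "-1"] by (simp add: cscale_minus_one[abs_def])

lemma commutant_adjoint:
  assumes R: "R \<in> commutant M"
  shows "adjoint R \<in> commutant M"
proof -
  note bR = commutantD(1)[OF R]
  have "adjoint R (T x) = T (adjoint R x)" if T: "T \<in> M" for T x
  proof (rule cinner_eqI)
    fix z
    have "cinner z (adjoint R (T x)) = cinner (adjoint T (R z)) x"
      by (simp add: adjoint[OF bR, symmetric] adjoint'[OF M_bounded[OF T]])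
    also have "\<dots> = cinner (R (adjoint T z)) x"
      by (simp add: commutantD(2)[OF R M_adjoint[OF T]])
    also have "\<dots> = cinner z (T (adjoint R x))"
      by (simp add: adjoint[OF bR] adjoint'[OF M_bounded[OF T]])
    finally show "cinner z (adjoint R (T x)) = cinner z (T (adjoint R x))" .
  qed
  then show ?thesis by (auto simp: commutant_def o_def bounded_op_adjoint[OF bR])
qed

text \<open>Stability is under the commutant, not under \<open>M\<close>: closed subspaces of this
  kind are those whose orthogonal projection lies in \<open>M\<close>.\<close>

definition invariant :: "'a set \<Rightarrow> bool" where
  "invariant K \<longleftrightarrow> csubspace K \<and> (\<forall>R\<in>commutant M. \<forall>x\<in>K. R x \<in> K)"

lemma invariantI:
  assumes "0 \<in> K" "\<And>x y. x \<in> K \<Longrightarrow> y \<in> K \<Longrightarrow> x + y \<in> K"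
    "\<And>R x. R \<in> commutant M \<Longrightarrow> x \<in> K \<Longrightarrow> R x \<in> K"
  shows "invariant K"
  using assms commutant_cscale by (auto simp: invariant_def csubspace_def)

lemma invariant_orth:
  assumes "invariant K"
  shows "invariant (orth K)"
  unfolding invariant_def
proof (intro conjI ballI csubspace_orth)
  fix R x assume R: "R \<in> commutant M" and x: "x \<in> orth K"
  show "R x \<in> orth K" unfolding orth_def
  proof (safe)
    fix k assume "k \<in> K"
    then have "adjoint R k \<in> K" using assms commutant_adjoint[OF R] by (auto simp: invariant_def)
    then show "cinner k (R x) = 0" using x by (simp add: adjoint'[OF commutantD(1)[OF R]] orth_def)
  qed
qed

lemma proj_commute:
  assumes K: "invariant K" "closed K" and R: "R \<in> commutant M"
  shows "proj K (R x) = R (proj K x)"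
proof -
  have K1: "csubspace K" and KR: "\<And>x. x \<in> K \<Longrightarrow> R x \<in> K"
    using K(1) R by (auto simp: invariant_def)
  have "R (x - proj K x) \<in> orth K"
    using invariant_orth[OF K(1)] R proj_diff[OF K1 K(2)] by (auto simp: invariant_def)
  then show ?thesis
    using proj_unique[OF K1 K(2) KR[OF proj_in[OF K1 K(2)]]]
    by (simp add: bounded_opD(3)[OF commutantD(1)[OF R]])
qed

lemma proj_mem:
  assumes "invariant K" "closed K"
  shows "proj K \<in> M"
  using assms by (intro M_memI bounded_op_proj proj_commute) (auto simp: invariant_def)

section \<open>Absolute values and partial isometries inside the algebra\<close>

lemma absolute_value_in:
  assumes S: "S \<in> M"
  obtains H where "H \<in> M" "\<And>x y. cinner (H x) y = cinner x (H y)"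
    "\<And>x. 0 \<le> Re (cinner x (H x))" "\<And>x. H (H x) = adjoint S (S x)" "\<And>x. norm (H x) = norm (S x)"
    "\<forall>R. bounded_op R \<longrightarrow> (\<forall>x. R (adjoint S (S x)) = adjoint S (S (R x))) \<longrightarrow>
      (\<forall>x. R (H x) = H (R x))"
proof -
  obtain H where H: "bounded_op H" "\<And>x y. cinner (H x) y = cinner x (H y)"
    "\<And>x. 0 \<le> Re (cinner x (H x))" "\<And>x. H (H x) = adjoint S (S x)" "\<And>x. norm (H x) = norm (S x)"
    "\<forall>R. bounded_op R \<longrightarrow> (\<forall>x. R (adjoint S (S x)) = adjoint S (S (R x))) \<longrightarrow>
      (\<forall>x. R (H x) = H (R x))"
    by (rule absolute_value_exists[OF M_bounded[OF S]]) (rule that; assumption)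
  have "H (R x) = R (H x)" if R: "R \<in> commutant M" for R x
    using H(6) commutantD(1)[OF R] commutantD(2)[OF R S] commutantD(2)[OF R M_adjoint[OF S]] by metis
  then have "H \<in> M" by (rule M_memI[OF H(1)])
  then show ?thesis by (rule that) (rule H)+
qed

text \<open>The graph of a partial isometry of \<open>M\<close> on a possibly non-closed subspace of
  its initial space. As relations these objects can be inverted, added and united along chains
  without carrying a domain; single-valuedness follows from the norm condition applied to
  differences.\<close>

definition isometric_rel :: "('a \<times> 'a) set \<Rightarrow> bool" where
  "isometric_rel G \<longleftrightarrow> (0, 0) \<in> G \<and>
    (\<forall>x y x' y'. (x, y) \<in> G \<longrightarrow> (x', y') \<in> G \<longrightarrow> (x + x', y + y') \<in> G) \<and>
    (\<forall>R\<in>commutant M. \<forall>x y. (x, y) \<in> G \<longrightarrow> (R x, R y) \<in> G) \<and>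
    (\<forall>x y. (x, y) \<in> G \<longrightarrow> norm x = norm y)"

lemma isometric_relD:
  assumes "isometric_rel G"
  shows "(0, 0) \<in> G" "\<And>x y x' y'. (x, y) \<in> G \<Longrightarrow> (x', y') \<in> G \<Longrightarrow> (x + x', y + y') \<in> G"
    "\<And>R x y. R \<in> commutant M \<Longrightarrow> (x, y) \<in> G \<Longrightarrow> (R x, R y) \<in> G"
    "\<And>x y. (x, y) \<in> G \<Longrightarrow> norm x = norm y"
  using assms by (auto simp: isometric_rel_def)

lemma isometric_rel_diff:
  assumes G: "isometric_rel G" and "(x, y) \<in> G" "(x', y') \<in> G"
  shows "(x - x', y - y') \<in> G"
  using isometric_relD(2)[OF G assms(2) isometric_relD(3)[OF G commutant_uminus assms(3)]] by simp

lemma isometric_rel_converse: "isometric_rel G \<Longrightarrow> isometric_rel (G\<inverse>)"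
  unfolding isometric_rel_def converse_iff by metis

lemma isometric_rel_unique:
  assumes G: "isometric_rel G" and "(x, y) \<in> G" "(x, y') \<in> G"
  shows "y = y'"
  using isometric_relD(4)[OF G isometric_rel_diff[OF assms]] by simp

lemma isometric_rel_fst_invariant:
  assumes "isometric_rel G"
  shows "invariant (fst ` G)"
proof (rule invariantI)
  show "0 \<in> fst ` G" using isometric_relD(1)[OF assms] by (force simp flip: Domain_fst)
  show "x + y \<in> fst ` G" if "x \<in> fst ` G" "y \<in> fst ` G" for x y
    using that isometric_relD(2)[OF assms] by (fastforce simp flip: Domain_fst)
  show "R x \<in> fst ` G" if "R \<in> commutant M" "x \<in> fst ` G" for R x
    using that isometric_relD(3)[OF assms] by (fastforce simp flip: Domain_fst)
qed

text \<open>Single-valuedness turns each closure property of \<open>G\<close> into an equation for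
  the chosen function, including commutation with the commutant, which puts it into
  \<open>M\<close>.\<close>

lemma isometric_rel_total:
  assumes G: "isometric_rel G" and tot: "\<And>x. \<exists>y. (x, y) \<in> G"
  obtains V where "V \<in> M" "\<And>x. (x, V x) \<in> G" "\<And>x. norm (V x) = norm x"
proof -
  obtain V where V: "\<And>x. (x, V x) \<in> G" using tot by metis
  note u = isometric_rel_unique[OF G V]
  have c: "V (R x) = R (V x)" if "R \<in> commutant M" for R x
    by (rule u) (rule isometric_relD(3)[OF G that V])
  have n: "norm (V x) = norm x" for x using isometric_relD(4)[OF G V] by simp
  have "bounded_op V"
    by (rule bounded_opI[of _ 1]) (auto simp: n c commutant_cscale intro!: u isometric_relD(2)[OF G V V])
  then have "V \<in> M" by (rule M_memI) (rule c)
  then show ?thesis using V n that by blast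
qed

lemma isometric_rel_closure:
  assumes G: "isometric_rel G"
  shows "isometric_rel (closure G)"
  unfolding isometric_rel_def
proof (intro conjI allI ballI impI)
  show "(0, 0) \<in> closure G" using closure_subset isometric_relD(1)[OF G] by blast
  fix x y assume "(x, y) \<in> closure G"
  then obtain f where f: "\<And>n. f n \<in> G" "f \<longlonglongrightarrow> (x, y)" by (metis closure_sequential)
  note f1 = tendsto_fst[OF f(2), simplified] and f2 = tendsto_snd[OF f(2), simplified]
  {
    fix x' y' assume "(x', y') \<in> closure G"
    then obtain g where g: "\<And>n. g n \<in> G" "g \<longlonglongrightarrow> (x', y')" by (metis closure_sequential)
    have "\<And>n. f n + g n \<in> G"
      using isometric_relD(2)[OF G, of "fst (f n)" "snd (f n)" "fst (g n)" "snd (g n)" for n] f(1) g(1)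
      by (simp add: plus_prod_def)
    moreover have "(\<lambda>n. f n + g n) \<longlonglongrightarrow> (x, y) + (x', y')" by (intro tendsto_add f g)
    ultimately show "(x + x', y + y') \<in> closure G"
      unfolding closure_sequential by (intro exI[of _ "\<lambda>n. f n + g n"]) simp
  }
  {
    fix R assume R: "R \<in> commutant M"
    have "\<And>n. (R (fst (f n)), R (snd (f n))) \<in> G"
      using isometric_relD(3)[OF G R, of "fst (f n)" "snd (f n)" for n] f(1) by simp
    moreover have "(\<lambda>n. (R (fst (f n)), R (snd (f n)))) \<longlonglongrightarrow> (R x, R y)"
      by (intro tendsto_Pair bounded_linear.tendsto[OF bounded_opD(1)[OF commutantD(1)[OF R]]] f1 f2)
    ultimately show "(R x, R y) \<in> closure G"
      unfolding closure_sequential by (intro exI[of _ "\<lambda>n. (R (fst (f n)), R (snd (f n)))"]) simp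
  }
  have "norm (fst (f n)) = norm (snd (f n))" for n
    using isometric_relD(4)[OF G, of "fst (f n)" "snd (f n)"] f(1) by simp
  then show "norm x = norm y"
    using tendsto_norm[OF f1] tendsto_norm[OF f2] by (simp add: LIMSEQ_unique)
qed

text \<open>Since differences also lie in \<open>G\<close>, a convergent sequence of first
  components has a Cauchy sequence of second components; closedness of \<open>G\<close> catches the
  limit pair.\<close>

lemma isometric_rel_closed_fst:
  assumes G: "isometric_rel G" "closed G"
  shows "closed (fst ` G)"
  unfolding closed_sequential_limits
proof (intro allI impI, elim conjE)
  fix f l assume f: "\<forall>n. f n \<in> fst ` G" and lim: "f \<longlonglongrightarrow> l"
  have "\<forall>n. \<exists>y. (f n, y) \<in> G" using f by force
  then obtain g where g: "\<And>n. (f n, g n) \<in> G" by metis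
  have "dist (g m) (g n) = dist (f m) (f n)" for m n
    using isometric_relD(4)[OF G(1) isometric_rel_diff[OF G(1) g g]] by (simp add: dist_norm)
  then have "Cauchy g" using LIMSEQ_imp_Cauchy[OF lim] by (simp add: Cauchy_def)
  then obtain k where "g \<longlonglongrightarrow> k" by (auto simp: Cauchy_convergent_iff convergent_def)
  then have "(\<lambda>n. (f n, g n)) \<longlonglongrightarrow> (l, k)" by (intro tendsto_Pair lim)
  then have "(l, k) \<in> G" by (rule closed_sequentially[OF G(2) g])
  then show "l \<in> fst ` G" by force
qed

lemma isometric_rel_closed_snd:
  assumes G: "isometric_rel G" "closed G"
  shows "closed (snd ` G)"
proof -
  have "closed (prod.swap -` G)"
    by (intro closed_vimage G) (simp add: prod.swap_def continuous_on_Pair continuous_on_fst continuous_on_snd)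
  moreover have "G\<inverse> = prod.swap -` G" by auto
  ultimately have "closed (fst ` (G\<inverse>))"
    by (intro isometric_rel_closed_fst isometric_rel_converse G(1)) simp
  then show ?thesis by (simp flip: Domain_fst Range_snd)
qed

text \<open>Pythagoras on both sides: orthogonality of domains and of ranges keeps the sum norm
  preserving.\<close>

lemma isometric_rel_sum:
  assumes G: "isometric_rel G" and G': "isometric_rel G'"
    and o: "\<And>x y x' y'. (x, y) \<in> G \<Longrightarrow> (x', y') \<in> G' \<Longrightarrow> cinner x x' = 0 \<and> cinner y y' = 0"
  shows "isometric_rel {(x + x', y + y') | x y x' y'. (x, y) \<in> G \<and> (x', y') \<in> G'}" (is "isometric_rel ?S")
proof -
  have mem: "(a, b) \<in> ?S" if "(x, y) \<in> G" "(x', y') \<in> G'" "a = x + x'" "b = y + y'" for a b x y x' y'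
    using that by blast
  show ?thesis unfolding isometric_rel_def
  proof (intro conjI allI ballI impI)
    show "(0, 0) \<in> ?S" by (rule mem[OF isometric_relD(1)[OF G] isometric_relD(1)[OF G']]) simp_all
    fix a b assume "(a, b) \<in> ?S"
    then obtain x y x' y' where 1: "(x, y) \<in> G" "(x', y') \<in> G'" "a = x + x'" "b = y + y'" by blast
    show "(R a, R b) \<in> ?S" if R: "R \<in> commutant M" for R
      by (rule mem[OF isometric_relD(3)[OF G R 1(1)] isometric_relD(3)[OF G' R 1(2)]])
        (simp_all add: 1 bounded_opD(2)[OF commutantD(1)[OF R]])
    have "(norm a)\<^sup>2 = (norm b)\<^sup>2"
      using o[OF 1(1,2)] isometric_relD(4)[OF G 1(1)] isometric_relD(4)[OF G' 1(2)]
      by (simp add: 1 norm_sq_add_orthogonal)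
    then show "norm a = norm b" by simp
    fix c d assume "(c, d) \<in> ?S"
    then obtain z w z' w' where 2: "(z, w) \<in> G" "(z', w') \<in> G'" "c = z + z'" "d = w + w'" by blast
    show "(a + c, b + d) \<in> ?S"
      by (rule mem[OF isometric_relD(2)[OF G 1(1) 2(1)] isometric_relD(2)[OF G' 1(2) 2(2)]])
        (simp_all add: 1 2 algebra_simps)
  qed
qed

text \<open>With \<open>H\<close> the absolute value of \<open>S\<close>, this relation is the polar
  part of \<open>S\<close> on the range of \<open>H\<close>, before any extension to the whole
  space.\<close>

lemma isometric_rel_range:
  assumes H: "H \<in> M" and S: "S \<in> M" and n: "\<And>x. norm (H x) = norm (S x)"
  shows "isometric_rel (range (\<lambda>x. (H x, S x)))" (is "isometric_rel ?G")
proof -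
  have mem: "(H x, S x) \<in> ?G" for x by auto
  note bH = bounded_opD[OF M_bounded[OF H]] and bS = bounded_opD[OF M_bounded[OF S]]
  show ?thesis unfolding isometric_rel_def
  proof (intro conjI allI ballI impI)
    show "(0, 0) \<in> ?G" using mem[of 0] by (simp add: bH bS)
    fix x y assume "(x, y) \<in> ?G"
    then obtain z where z: "x = H z" "y = S z" by auto
    show "norm x = norm y" by (simp add: z n)
    show "(R x, R y) \<in> ?G" if "R \<in> commutant M" for R
      using mem[of "R z"] by (simp add: z commutantD(2)[OF that] H S)
    fix x' y' assume "(x', y') \<in> ?G"
    then obtain z' where z': "x' = H z'" "y' = S z'" by auto
    show "(x + x', y + y') \<in> ?G" using mem[of "z + z'"] by (simp add: z z' bH bS)
  qed
qed

lemma isometric_rel_maximal: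
  assumes "isometric_rel G0"
  obtains G where "isometric_rel G" "G0 \<subseteq> G" "\<And>G'. isometric_rel G' \<Longrightarrow> G \<subseteq> G' \<Longrightarrow> G' = G"
proof -
  define \<A> where "\<A> = {G. isometric_rel G \<and> G0 \<subseteq> G}"
  have "\<exists>G\<in>\<A>. \<forall>X\<in>\<A>. G \<subseteq> X \<longrightarrow> X = G"
  proof (rule subset_Zorn_nonempty)
    show "\<A> \<noteq> {}" using assms by (auto simp: \<A>_def)
    fix C assume ne: "C \<noteq> {}" and ch: "subset.chain \<A> C"
    have C: "\<And>G. G \<in> C \<Longrightarrow> isometric_rel G \<and> G0 \<subseteq> G" using ch by (auto simp: subset.chain_def \<A>_def)
    have "isometric_rel (\<Union>C)" unfolding isometric_rel_def
    proof (intro conjI allI ballI impI)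
      show "(0, 0) \<in> \<Union>C" using ne C isometric_relD(1) by blast
      fix x y assume "(x, y) \<in> \<Union>C"
      then obtain G where G: "G \<in> C" "(x, y) \<in> G" by blast
      show "norm x = norm y" using isometric_relD(4) C[OF G(1)] G(2) by blast
      show "(R x, R y) \<in> \<Union>C" if "R \<in> commutant M" for R
        using isometric_relD(3) C[OF G(1)] G that by blast
      fix x' y' assume "(x', y') \<in> \<Union>C"
      then obtain G' where G': "G' \<in> C" "(x', y') \<in> G'" by blast
      have "G \<subseteq> G' \<or> G' \<subseteq> G" using ch G(1) G'(1) by (auto simp: subset.chain_def)
      then obtain D where "D \<in> C" "(x, y) \<in> D" "(x', y') \<in> D" using G G' by blast
      then show "(x + x', y + y') \<in> \<Union>C" using isometric_relD(2) C by blast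
    qed
    moreover have "G0 \<subseteq> \<Union>C" using ne C by blast
    ultimately show "\<Union>C \<in> \<A>" by (simp add: \<A>_def)
  qed
  then show ?thesis using that by (auto simp: \<A>_def)
qed

end

section \<open>Finite algebras: extension to unitaries and polar decomposition\<close>

locale finite_vN_algebra = vN_algebra +
  assumes fin: "finite_vna M"
begin

text \<open>The only direct use of finiteness; all later uses go through this surjectivity.\<close>

lemma isometry_surj:
  assumes V: "V \<in> M" "\<And>x. norm (V x) = norm x"
  shows "V (adjoint V y) = y"
proof -
  have "adjoint V \<circ> V = id" by (rule isometry_adjoint[OF M_bounded[OF V(1)] V(2)])
  then have "V \<circ> adjoint V = id" using fin V(1) by (simp add: finite_vna_def)
  then show ?thesis by (simp add: fun_eq_iff)
qed

text \<open>For a maximal isometric relation, \<open>M\<close> has no nonzero element mapping the complement of the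
  domain to the complement of the range. A central projection then separates the two complements,
  and gluing the inverse relation with the identity along it yields an isometry in \<open>M\<close> whose
  range misses the first complement.\<close>

lemma isometric_rel_extends_to_unitary:
  assumes G0: "isometric_rel G0"
  obtains U where "U \<in> M" "\<And>x. norm (U x) = norm x" "\<And>x y. (x, y) \<in> G0 \<Longrightarrow> U x = y"
proof -
  obtain G where G: "isometric_rel G" "G0 \<subseteq> G"
    and maximal: "\<And>G'. isometric_rel G' \<Longrightarrow> G \<subseteq> G' \<Longrightarrow> G' = G"
    using isometric_rel_maximal[OF G0] by metis
  have clG: "closed G"
    using maximal[OF isometric_rel_closure[OF G(1)] closure_subset] closed_closure by metis
  define D where "D = fst ` G"
  define E where "E = snd ` G"
  have memD: "x \<in> D \<longleftrightarrow> (\<exists>y. (x, y) \<in> G)" and memE: "y \<in> E \<longleftrightarrow> (\<exists>x. (x, y) \<in> G)" for x y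
    by (simp_all add: D_def E_def Domain_iff Range_iff flip: Domain_fst Range_snd)
  have D: "invariant D" "closed D"
    unfolding D_def by (rule isometric_rel_fst_invariant[OF G(1)] isometric_rel_closed_fst[OF G(1) clG])+
  have E_conv: "E = fst ` (G\<inverse>)" by (simp add: E_def flip: Domain_fst Range_snd)
  have E: "invariant E" "closed E"
    using isometric_rel_fst_invariant[OF isometric_rel_converse[OF G(1)]]
      isometric_rel_closed_snd[OF G(1) clG] by (simp_all add: E_conv[symmetric] E_def[symmetric])
  define K where "K = orth D"
  define L where "L = orth E"
  have K: "invariant K" "closed K" and L: "invariant L" "closed L"
    unfolding K_def L_def by (rule invariant_orth D E closed_orth)+
  note cD = D(1)[unfolded invariant_def, THEN conjunct1]
    and cE = E(1)[unfolded invariant_def, THEN conjunct1]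
    and cK = K(1)[unfolded invariant_def, THEN conjunct1]
    and cL = L(1)[unfolded invariant_def, THEN conjunct1]
  \<comment> \<open>If \<open>R\<close> had a nonzero corner from \<open>K\<close> to
    \<open>L\<close>, the polar part \<open>G'\<close> of that corner would be orthogonal to
    \<open>G\<close> on both sides, so \<open>G\<close> plus \<open>G'\<close> would extend
    \<open>G\<close>. Maximality puts \<open>S k\<close> into \<open>E\<close>, while it also lies
    in \<open>L\<close>, the complement of \<open>E\<close>.\<close>
  have KL: "cinner (R k) l = 0" if R: "R \<in> M" and k: "k \<in> K" and l: "l \<in> L" for R k l
  proof -
    define S where "S = (\<lambda>x. proj L (R (proj K x)))"
    have S: "S \<in> M" unfolding S_def by (rule M_compose[OF proj_mem[OF L] M_compose[OF R proj_mem[OF K]]])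
    obtain H where H: "H \<in> M" "\<And>x y. cinner (H x) y = cinner x (H y)" "\<And>x. norm (H x) = norm (S x)"
      by (rule absolute_value_in[OF S]) (rule that; assumption)
    define G' where "G' = range (\<lambda>x. (H x, S x))"
    have mem: "(H x, S x) \<in> G'" for x by (auto simp: G'_def)
    have G': "isometric_rel G'" unfolding G'_def by (rule isometric_rel_range[OF H(1) S H(3)])
    have SL: "S x \<in> L" for x unfolding S_def by (rule proj_in[OF cL L(2)])
    have o: "cinner x x' = 0 \<and> cinner y y' = 0" if xy: "(x, y) \<in> G" and "(x', y') \<in> G'" for x y x' y'
    proof -
      obtain z where z: "x' = H z" "y' = S z" using \<open>(x', y') \<in> G'\<close> by (auto simp: G'_def)
      have xD: "x \<in> D" and yE: "y \<in> E" using xy by (auto simp: memD memE)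
      have "x \<in> orth K" using xD cinner_eq_zero_commute by (auto simp: K_def orth_def)
      then have "S x = 0" unfolding S_def
        by (simp add: proj_of_orth[OF cK K(2)] bounded_opD(6)[OF M_bounded[OF R]]
            bounded_opD(6)[OF bounded_op_proj[OF cL L(2)]])
      then have "H x = 0" using H(3)[of x] by simp
      then have "cinner x x' = 0" using H(2)[of x z] by (simp add: z)
      moreover have "cinner y y' = 0" using SL[of z] yE by (simp add: z L_def orth_def)
      ultimately show ?thesis by simp
    qed
    have "G \<subseteq> {(x + x', y + y') | x y x' y'. (x, y) \<in> G \<and> (x', y') \<in> G'}"
    proof (clarify)
      fix x y assume "(x, y) \<in> G"
      then show "\<exists>u v x' y'. (x, y) = (u + x', v + y') \<and> (u, v) \<in> G \<and> (x', y') \<in> G'"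
        using isometric_relD(1)[OF G'] by (metis add.right_neutral)
    qed
    from maximal[OF isometric_rel_sum[OF G(1) G' o] this]
    have sum: "\<And>x y x' y'. (x, y) \<in> G \<Longrightarrow> (x', y') \<in> G' \<Longrightarrow> (x + x', y + y') \<in> G" by blast
    have "(H k, S k) \<in> G" using sum[OF isometric_relD(1)[OF G(1)] mem[of k]] by simp
    then have "S k \<in> E" by (auto simp: memE)
    then have "cinner (S k) (S k) = 0" using SL[of k] by (simp add: L_def orth_def)
    then have "proj L (R k) = 0" by (simp add: S_def proj_of_mem[OF cK K(2) k])
    then show ?thesis
      using proj_selfadjoint[OF cL L(2), of "R k" l] by (simp add: proj_of_mem[OF cL L(2) l])
  qed
  \<comment> \<open>\<open>N\<close> is the complement of everything \<open>M\<close> can reach from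
    \<open>K\<close>. It is stable under both \<open>M\<close> and its commutant, so its projection
    \<open>p\<close> is central; by \<open>KL\<close> it contains \<open>L\<close>, and it is
    orthogonal to \<open>K\<close> because the identity is in \<open>M\<close>.\<close>
  define N where "N = orth {R k | R k. R \<in> M \<and> k \<in> K}"
  have memN: "y \<in> N \<longleftrightarrow> (\<forall>R\<in>M. \<forall>k\<in>K. cinner (R k) y = 0)" for y
    by (auto simp: N_def orth_def)
  have cN: "csubspace N" and clN: "closed N" unfolding N_def by (rule csubspace_orth closed_orth)+
  have invN: "invariant N" unfolding invariant_def
  proof (intro conjI ballI cN)
    fix T y assume T: "T \<in> commutant M" and y: "y \<in> N"
    have "cinner (R k) (T y) = 0" if R: "R \<in> M" and k: "k \<in> K" for R k
    proof -
      have T': "adjoint T \<in> commutant M" by (rule commutant_adjoint[OF T])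
      have "adjoint T k \<in> K" using K(1) T' k by (simp add: invariant_def)
      then have "cinner (R (adjoint T k)) y = 0" using y R by (auto simp: memN)
      then show ?thesis by (simp add: adjoint'[OF commutantD(1)[OF T]] commutantD(2)[OF T' R])
    qed
    then show "T y \<in> N" by (simp add: memN)
  qed
  define p where "p = proj N"
  have pN: "p x \<in> N" and p_orth: "x - p x \<in> orth N" for x
    unfolding p_def by (rule proj_in[OF cN clN] proj_diff[OF cN clN])+
  have NM: "T y \<in> N" if T: "T \<in> M" and y: "y \<in> N" for T y
  proof -
    have "cinner (R k) (T y) = 0" if R: "R \<in> M" and k: "k \<in> K" for R k
    proof -
      have "\<forall>k\<in>K. cinner (adjoint T (R k)) y = 0"
        using bspec[OF y[unfolded memN] M_compose[OF M_adjoint[OF T] R]] .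
      with k have "cinner (adjoint T (R k)) y = 0" by simp
      then show ?thesis by (simp add: adjoint'[OF M_bounded[OF T]])
    qed
    then show ?thesis by (simp add: memN)
  qed
  have p_central: "p \<in> commutant M"
  proof -
    have "p (T x) = T (p x)" if T: "T \<in> M" for T x
    proof -
      have "T (x - p x) \<in> orth N" unfolding orth_def
      proof (safe)
        fix y assume "y \<in> N"
        then have "adjoint T y \<in> N" using NM M_adjoint[OF T] by blast
        then show "cinner y (T (x - p x)) = 0"
          using p_orth[of x] by (simp add: adjoint'[OF M_bounded[OF T]] orth_def)
      qed
      then have "proj N (T x) = T (p x)"
        by (intro proj_unique[OF cN clN NM[OF T pN]]) (simp add: bounded_opD(3)[OF M_bounded[OF T]])
      then show ?thesis by (simp add: p_def)
    qed
    then show ?thesis by (auto simp: commutant_def o_def p_def bounded_op_proj[OF cN clN])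
  qed

  note bp = bounded_opD[OF bounded_op_proj[OF cN clN], folded p_def]
  have LN: "L \<subseteq> N" using KL by (auto simp: memN)
  have KN: "cinner k y = 0" if "k \<in> K" "y \<in> N" for k y
    using that M_id(1) unfolding memN by (metis id_apply)
  \<comment> \<open>The identity on \<open>N\<close> glued to the inverse of \<open>G\<close> on the
    complement of \<open>N\<close>. That complement lies in \<open>E\<close>, so \<open>Q\<close> is
    total. Centrality of \<open>p\<close> keeps \<open>d\<close> orthogonal to \<open>N\<close>, so
    \<open>Q\<close> is isometric.\<close>
  define Q where "Q = {(x, p x + d) | x d. (d, x - p x) \<in> G}"
  have memQ: "(x, y) \<in> Q \<longleftrightarrow> (y - p x, x - p x) \<in> G" for x y
    unfolding Q_def by (auto intro!: exI[of _ "y - p x"])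
  have pd: "p d = 0" if "(d, x - p x) \<in> G" for d x
  proof -
    have "(p d, p (x - p x)) \<in> G" by (rule isometric_relD(3)[OF G(1) p_central that])
    moreover have "p (x - p x) = 0"
      unfolding p_def using proj_of_orth[OF cN clN] p_orth[of x, unfolded p_def] by blast
    ultimately show ?thesis using isometric_relD(4)[OF G(1), of "p d" 0] by simp
  qed
  have Q: "isometric_rel Q" unfolding isometric_rel_def
  proof (intro conjI allI ballI impI)
    show "(0, 0) \<in> Q" using isometric_relD(1)[OF G(1)] by (simp add: memQ bp)
    fix x y assume xy: "(x, y) \<in> Q"
    show "(x + x', y + y') \<in> Q" if "(x', y') \<in> Q" for x' y'
      using isometric_relD(2)[OF G(1) xy[unfolded memQ] that[unfolded memQ]]
      by (simp add: memQ bp algebra_simps)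
    show "(R x, R y) \<in> Q" if R: "R \<in> commutant M" for R
      using isometric_relD(3)[OF G(1) R xy[unfolded memQ]]
      by (simp add: memQ bounded_opD(3)[OF commutantD(1)[OF R]] p_def proj_commute[OF invN clN R])
    define d where "d = y - p x"
    have dG: "(d, x - p x) \<in> G" using xy by (simp add: memQ d_def)
    have "d \<in> orth N" using p_orth[of d] pd[OF dG] by simp
    then have "cinner (p x) d = 0" using pN[of x] by (simp add: orth_def)
    then have "(norm (p x + d))\<^sup>2 = (norm (p x))\<^sup>2 + (norm (x - p x))\<^sup>2"
      using isometric_relD(4)[OF G(1) dG] by (simp add: norm_sq_add_orthogonal)
    also have "\<dots> = (norm x)\<^sup>2" using norm_sq_proj[OF cN clN, of x] by (simp add: p_def)
    finally show "norm x = norm y" by (simp add: d_def)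
  qed
  have "\<exists>y. (x, y) \<in> Q" for x
  proof -
    have "x - p x \<in> orth L" using p_orth[of x] LN by (auto simp: orth_def)
    then have "x - p x \<in> E" unfolding L_def by (rule orth_orth[OF cE E(2)])
    then obtain d where "(d, x - p x) \<in> G" by (auto simp: memE)
    then show ?thesis by (intro exI[of _ "p x + d"]) (simp add: memQ)
  qed
  with Q obtain V where V: "V \<in> M" "\<And>x. (x, V x) \<in> Q" "\<And>x. norm (V x) = norm x"
    using isometric_rel_total[of Q] by metis
  \<comment> \<open>Values of \<open>V\<close> lie in \<open>N\<close> plus \<open>D\<close>, and
    \<open>K\<close> is orthogonal to both. Since finiteness makes \<open>V\<close> onto,
    \<open>K\<close> vanishes, so \<open>G\<close> is total.\<close>
  have K0: "k = 0" if k: "k \<in> K" for k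
  proof -
    define x where "x = adjoint V k"
    have "(x, k) \<in> Q" using V(2)[of x] isometry_surj[OF V(1,3), of k] by (simp add: x_def)
    then have "k - p x \<in> D" by (auto simp: memQ memD)
    then have "cinner (k - p x) k = 0" using k by (simp add: K_def orth_def)
    moreover have "cinner (p x) k = 0" using KN[OF k pN[of x]] cinner_eq_zero_commute by blast
    ultimately show ?thesis by (simp add: cinner_diff_left)
  qed
  have tot: "\<exists>y. (x, y) \<in> G" for x
  proof -
    have "cinner k x = 0" if "k \<in> orth D" for k using K0[of k] that by (simp add: K_def)
    then have "x \<in> orth (orth D)" by (simp add: orth_def[of "orth D"])
    then have "x \<in> D" by (rule orth_orth[OF cD D(2)])
    then show ?thesis by (simp add: memD)
  qed
  obtain U where U: "U \<in> M" "\<And>x. (x, U x) \<in> G" "\<And>x. norm (U x) = norm x"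
    using isometric_rel_total[OF G(1) tot] by metis
  have "U x = y" if "(x, y) \<in> G0" for x y
    using isometric_rel_unique[OF G(1) U(2)] that G(2) by blast
  with U(1,3) show ?thesis by (rule that)
qed

text \<open>The isometric map taking \<open>H x\<close> to \<open>S x\<close> extends to a unitary
  of the algebra, so the polar factor can be taken unitary even when \<open>S\<close> has a
  kernel.\<close>

lemma polar_decomposition:
  assumes S: "S \<in> M"
  obtains U H where "U \<in> M" "\<And>x. norm (U x) = norm x" "\<And>x. U (adjoint U x) = x"
    "H \<in> M" "\<And>x y. cinner (H x) y = cinner x (H y)"
    "\<And>x. 0 \<le> Re (cinner x (H x))" "\<And>x. H (H x) = adjoint S (S x)" "\<And>x. S x = U (H x)"
    "\<forall>R. bounded_op R \<longrightarrow> (\<forall>x. R (adjoint S (S x)) = adjoint S (S (R x))) \<longrightarrow>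
      (\<forall>x. R (H x) = H (R x))"
proof -
  obtain H where H: "H \<in> M" "\<And>x y. cinner (H x) y = cinner x (H y)"
    "\<And>x. 0 \<le> Re (cinner x (H x))" "\<And>x. H (H x) = adjoint S (S x)" "\<And>x. norm (H x) = norm (S x)"
    "\<forall>R. bounded_op R \<longrightarrow> (\<forall>x. R (adjoint S (S x)) = adjoint S (S (R x))) \<longrightarrow>
      (\<forall>x. R (H x) = H (R x))"
    by (rule absolute_value_in[OF S]) (rule that; assumption)
  define G where "G = range (\<lambda>x. (H x, S x))"
  have mem: "(H x, S x) \<in> G" for x by (auto simp: G_def)
  have "isometric_rel G" unfolding G_def by (rule isometric_rel_range[OF H(1) S H(5)])
  then obtain U where U: "U \<in> M" "\<And>x. norm (U x) = norm x" "\<And>x y. (x, y) \<in> G \<Longrightarrow> U x = y"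
    by (rule isometric_rel_extends_to_unitary) (rule that; assumption)
  have "U (adjoint U x) = x" for x by (rule isometry_surj[OF U(1,2)])
  moreover have "S x = U (H x)" for x using U(3)[OF mem] by simp
  ultimately show ?thesis using U(1,2) H(1,2,3,4,6) by (intro that[of U H])
qed

end

section \<open>Clean decompositions\<close>

lemma proj_reduce:
  assumes K: "csubspace K" "closed K"
    and B: "bounded_op B" "\<And>x y. cinner (B x) y = cinner x (B y)" "\<And>x. x \<in> K \<Longrightarrow> B x \<in> K"
  shows "proj K (B x) = B (proj K x)"
proof (rule proj_unique[OF K B(3)[OF proj_in[OF K]]])
  have "cinner y (B (x - proj K x)) = 0" if "y \<in> K" for y
    using proj_diff[OF K, of x] B(3)[OF that] by (simp add: B(2)[symmetric] orth_def)
  then show "B x - B (proj K x) \<in> orth K"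
    by (simp add: orth_def bounded_opD(3)[OF B(1)])
qed

text \<open>The inequality C^2 <= C, read off from positivity of \<open>C\<close> at
  \<open>x - C x\<close>. Contractivity is asked only at \<open>C x\<close>, because the application
  verifies it only on the range of \<open>e\<close>.\<close>

lemma positive_contraction_norm_sq_le:
  assumes C: "bounded_op C" "\<And>x y. cinner (C x) y = cinner x (C y)" "\<And>x. 0 \<le> Re (cinner x (C x))"
    and le: "norm (C (C x)) \<le> norm (C x)"
  shows "(norm (C x))\<^sup>2 \<le> Re (cinner x (C x))"
proof -
  have "Re (cinner (C x) (C (C x))) \<le> norm (C x) * norm (C x)"
    by (rule order_trans[OF Re_cinner_le]) (intro mult_left_mono le norm_ge_zero)
  moreover have "0 \<le> Re (cinner (x - C x) (C (x - C x)))" by (rule C(3))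
  moreover have "Re (cinner x (C (C x))) = (norm (C x))\<^sup>2" by (simp add: norm_sq_cinner C(2))
  ultimately show ?thesis
    by (simp add: bounded_opD(3)[OF C(1)] cinner_simps norm_sq_cinner) (simp add: cinner_self power2_eq_square)
qed

text \<open>The scalar core of the constant 4. For the components x in eH and y in the complement:
  \<open>n\<close> = |x|, \<open>f\<close> = |y|, \<open>a\<close> = |Ty|, \<open>b\<close> =
  |Cx|^2, and \<open>g\<close>, \<open>d\<close> are the norms of the components of Px in fH and in
  its complement; \<open>s\<close> and \<open>t\<close> are the norms of the two components of (T -
  P)(x + y).\<close>

lemma lower_bound_estimate:
  fixes n b g d a s t f :: real
  assumes n: "0 \<le> n" and b: "0 \<le> b" "b \<le> n\<^sup>2" and g: "0 \<le> g" "2 * n\<^sup>2 - b \<le> g * n"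
    and d: "d\<^sup>2 = 5 * n\<^sup>2 - 4 * b - g\<^sup>2" and f: "0 \<le> f" "f \<le> 2 * a"
    and s: "g - n / 2 \<le> s" and t: "\<bar>a - d\<bar> \<le> t"
  shows "(n\<^sup>2 + f\<^sup>2) / 16 \<le> s\<^sup>2 + t\<^sup>2"
proof -
  have gn: "n \<le> g"
  proof (cases "n = 0")
    case False
    have "n * n \<le> g * n" using b(2) g(2) by (simp add: power2_eq_square)
    then show ?thesis using n False by (simp add: mult_le_cancel_right)
  qed (simp add: g)
  have "(a - d)\<^sup>2 \<le> t\<^sup>2" using t by (metis abs_le_square_iff abs_ge_self order_trans)
  moreover have "f\<^sup>2 \<le> (2 * a)\<^sup>2" using f by (intro power_mono)
  \<comment> \<open>Young's inequality: with \<open>f \<le> 2 * a\<close>, the coefficient 1/4 of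
    a^2 leaves exactly f^2 / 16, and 1/3 is then the smallest possible coefficient of d^2.\<close>
  moreover have "(a - d)\<^sup>2 - (a\<^sup>2 / 4 - d\<^sup>2 / 3) = (3 * a - 4 * d)\<^sup>2 / 12"
    by (simp add: power2_eq_square field_simps)
  then have "a\<^sup>2 / 4 - d\<^sup>2 / 3 \<le> (a - d)\<^sup>2"
    using zero_le_power2[of "3 * a - 4 * d"] by linarith
  ultimately have t2: "f\<^sup>2 / 16 - d\<^sup>2 / 3 \<le> t\<^sup>2" by (simp add: power_mult_distrib)
  have s2: "(g - n / 2)\<^sup>2 \<le> s\<^sup>2" using s gn n by (intro power_mono) auto
  \<comment> \<open>Three times the remaining inequality n^2/16 + d^2/3 <= (g - n/2)^2, with
    \<open>d\<close> eliminated; 71/16 is 5 + 3/16 - 3/4.\<close>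
  have "0 \<le> 4 * g\<^sup>2 - 3 * (g * n) - 71/16 * n\<^sup>2 + 4 * b"
  proof (cases "n = 0")
    case True
    then show ?thesis using b by simp
  next
    case False
    define m h k where "m = n\<^sup>2" and "h = 2 * n\<^sup>2 - b" and "k = g * n"
    have hk: "h \<le> k" "m \<le> h" "0 < m" using g b False by (auto simp: m_def h_def k_def)
    \<comment> \<open>After multiplication by n^2 the expression increases in \<open>k\<close>
      beyond \<open>h\<close>, and at \<open>k = h\<close> it equals the sum of squares in the next
      line.\<close>
    have "0 \<le> (k - h) * (4 * (k + h) - 3 * m)" using hk by (intro mult_nonneg_nonneg) auto
    moreover have "0 \<le> (2 * b - 9/4 * m)\<^sup>2 + m\<^sup>2 / 2" by simp
    moreover have "h = 2 * m - b" by (simp add: h_def m_def)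
    ultimately have "0 \<le> 4 * k\<^sup>2 - 3 * (k * m) - 71/16 * m\<^sup>2 + 4 * (b * m)"
      by (simp add: power2_eq_square algebra_simps)
    also have "\<dots> = m * (4 * g\<^sup>2 - 3 * (g * n) - 71/16 * n\<^sup>2 + 4 * b)"
      by (simp add: m_def k_def power2_eq_square algebra_simps)
    finally show ?thesis using hk(3) by (simp add: zero_le_mult_iff)
  qed
  then have "n\<^sup>2 / 16 + d\<^sup>2 / 3 \<le> (g - n / 2)\<^sup>2"
    unfolding d by (simp add: power2_eq_square field_simps)
  with s2 t2 show ?thesis by simp
qed

section \<open>Invertibility, spectral splitting and the idempotent\<close>

context finite_vN_algebra
begin

text \<open>The self-adjoint factor \<open>H\<close> inherits the lower bound, so its range is
  closed and the complement of the range, being its kernel, is zero. Thus \<open>H\<close> is onto,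
  and so is \<open>S\<close> because the polar factor is unitary; a non-unitary isometry shows that
  this needs finiteness.\<close>

lemma bounded_below_invertible:
  assumes S: "S \<in> M" and c: "c > 0" "\<And>x. c * norm x \<le> norm (S x)"
  obtains R where "R \<in> M" "\<And>x. R (S x) = x" "\<And>x. S (R x) = x" "\<And>x. c * norm (R x) \<le> norm x"
proof -
  obtain U H where U: "U \<in> M" "\<And>x. norm (U x) = norm x" "\<And>x. U (adjoint U x) = x"
    and H: "H \<in> M" "\<And>x y. cinner (H x) y = cinner x (H y)" and SUH: "\<And>x. S x = U (H x)"
    by (rule polar_decomposition[OF S]) (rule that; assumption)
  note bH = bounded_opD[OF M_bounded[OF H(1)]] and bS = bounded_opD[OF M_bounded[OF S]]
  have Hb: "c * norm x \<le> norm (H x)" for x using c(2)[of x] by (simp add: SUH U(2))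
  have inj: "x = y" if "S x = S y" for x y
    using c(2)[of "x - y"] c(1) that by (simp add: bS(3) mult_le_0_iff)
  have cl: "closed (range H)"
    by (intro complete_imp_closed complete_isometric_image[OF c(1) subspace_UNIV bH(1)])
      (simp_all add: Hb complete_UNIV)
  have cs: "csubspace (range H)"
    unfolding csubspace_def
    using rangeI[of H 0] by (auto simp: bH(6) simp flip: bH(2,4))
  have "y \<in> range H" for y
  proof (rule orth_orth[OF cs cl])
    have "cinner z y = 0" if "z \<in> orth (range H)" for z
    proof -
      have "H z = 0" using that by (intro cinner_eqI) (simp add: orth_def H(2))
      then have "z = 0" using Hb[of z] c(1) by (simp add: mult_le_0_iff)
      then show ?thesis by simp
    qed
    then show "y \<in> orth (orth (range H))" by (simp add: orth_def[of "orth (range H)"])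
  qed
  then have "\<exists>x. S x = y" for y
    using U(3)[of y] by (metis SUH rangeE)
  then obtain R where SR: "\<And>y. S (R y) = y" by metis
  have RS: "R (S x) = x" for x by (rule inj) (rule SR)
  have Rb: "c * norm (R x) \<le> norm x" for x using c(2)[of "R x"] by (simp add: SR)
  have "bounded_op R"
  proof (rule bounded_opI)
    show "R (x + y) = R x + R y" for x y by (rule inj) (simp add: SR bS(2))
    show "R (cscale k x) = cscale k (R x)" for k x by (rule inj) (simp add: SR bS(4))
    show "norm (R x) \<le> (1/c) * norm x" for x using Rb[of x] c(1) by (simp add: field_simps)
  qed
  moreover have "R (Q x) = Q (R x)" if Q: "Q \<in> commutant M" for Q x
    by (rule inj) (simp add: SR flip: commutantD(2)[OF Q S])
  ultimately have "R \<in> M" by (rule M_memI)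
  then show ?thesis using RS SR Rb by (rule that)
qed

text \<open>With \<open>A\<close> equal to T*T - 1/4 and \<open>H\<close> its absolute value, the
  kernel of H + A is the spectral subspace where T*T <= 1/4: there A = -H is negative, and on the
  complement A = H is positive. The threshold 1/4 is the square of the norm bound 1/2.\<close>

lemma spectral_splitting:
  assumes T: "T \<in> M"
  obtains K where "invariant K" "closed K" "\<And>x. x \<in> K \<Longrightarrow> adjoint T (T x) \<in> K"
    "\<And>x. x \<in> K \<Longrightarrow> 2 * norm (T x) \<le> norm x" "\<And>x. x \<in> orth K \<Longrightarrow> norm x \<le> 2 * norm (T x)"
proof -
  define A where "A = (\<lambda>x. adjoint T (T x) - (1/4) *\<^sub>R x)"
  have A: "A \<in> M" unfolding A_def
    by (rule M_diff[OF M_compose[OF M_adjoint[OF T] T] M_scaleR[OF M_id(2)]])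
  note bT = M_bounded[OF T] and bA = bounded_opD[OF M_bounded[OF A]]
  have sA: "cinner (A x) y = cinner x (A y)" for x y
    by (simp add: A_def cinner_simps adjoint[OF bT, symmetric] adjoint'[OF bT, symmetric])
  have adA: "adjoint A = A" by (rule adjoint_unique[OF M_bounded[OF A] sA])
  obtain H where H: "H \<in> M" "\<And>x y. cinner (H x) y = cinner x (H y)"
    "\<And>x. 0 \<le> Re (cinner x (H x))" "\<And>x. H (H x) = adjoint A (A x)" "\<And>x. norm (H x) = norm (A x)"
    "\<forall>R. bounded_op R \<longrightarrow> (\<forall>x. R (adjoint A (A x)) = adjoint A (A (R x))) \<longrightarrow>
      (\<forall>x. R (H x) = H (R x))"
    by (rule absolute_value_in[OF A]) (rule that; assumption)
  note bH = bounded_opD[OF M_bounded[OF H(1)]]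
  have AH: "A (H x) = H (A x)" for x using H(6) M_bounded[OF A] by (simp add: adA)
  have HH: "H (H x) = A (A x)" for x using H(4) by (simp add: adA)
  define K where "K = {x. H x + A x = 0}"
  have T2: "4 * (norm (T x))\<^sup>2 = (norm x)\<^sup>2 + 4 * Re (cinner x (A x))" for x
    by (simp add: A_def cinner_simps adjoint[OF bT, symmetric] cinner_self)
  have inv: "invariant K"
  proof (rule invariantI)
    show "R x \<in> K" if R: "R \<in> commutant M" and "x \<in> K" for R x
    proof -
      have "H (R x) + A (R x) = R (H x + A x)"
        by (simp add: commutantD(2)[OF R] H(1) A bounded_opD(2)[OF commutantD(1)[OF R]])
      then show ?thesis using \<open>x \<in> K\<close> by (simp add: K_def bounded_opD(6)[OF commutantD(1)[OF R]])
    qed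
    show "x + y \<in> K" if "x \<in> K" "y \<in> K" for x y
    proof -
      have "H (x + y) + A (x + y) = (H x + A x) + (H y + A y)" by (simp add: bH(2) bA(2))
      then show ?thesis using that by (simp add: K_def)
    qed
  qed (simp add: K_def bH bA)
  have cl: "closed K" unfolding K_def
    by (intro closed_Collect_eq continuous_intros linear_continuous_on bH(1) bA(1))
  have A_K: "A x \<in> K" if "x \<in> K" for x
  proof -
    have "H (A x) + A (A x) = A (H x + A x)" by (simp add: AH bA(2))
    then show ?thesis using that by (simp add: K_def bA(6))
  qed
  show ?thesis
  proof (rule that[OF inv cl])
    note cK = csubspaceD[OF inv[unfolded invariant_def, THEN conjunct1]]
    show "adjoint T (T x) \<in> K" if "x \<in> K" for x
      using cK(2)[OF A_K[OF that] cK(4)[OF that, of "1/4"]] by (simp add: A_def)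
    show "2 * norm (T x) \<le> norm x" if "x \<in> K" for x
    proof (rule power2_le_imp_le)
      have "A x = - H x" using that by (simp add: K_def eq_neg_iff_add_eq_0 add.commute)
      then show "(2 * norm (T x))\<^sup>2 \<le> (norm x)\<^sup>2"
        using T2[of x] H(3)[of x] by (simp add: cinner_minus_right power_mult_distrib)
    qed simp
    show "norm x \<le> 2 * norm (T x)" if x: "x \<in> orth K" for x
    proof (rule power2_le_imp_le)
      have "A x = H x"
      proof (rule cinner_eqI)
        fix z
        \<comment> \<open>(H + A)(A - H) = A^2 - H^2 = 0, since \<open>A\<close> and
          \<open>H\<close> commute and have the same square.\<close>
        have "A z - H z \<in> K" by (simp add: K_def bH bA AH HH)
        then have "cinner (A z - H z) x = 0" using x by (simp add: orth_def)
        then show "cinner z (A x) = cinner z (H x)" by (simp add: cinner_diff_left sA H(2))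
      qed
      then show "(norm x)\<^sup>2 \<le> (2 * norm (T x))\<^sup>2"
        using T2[of x] H(3)[of x] by (simp add: power_mult_distrib)
    qed simp
  qed
qed

text \<open>With \<open>e\<close> the spectral projection of \<open>T\<close> and \<open>f = U e U\<^sup>*\<close> its transport by the polar part of \<open>T\<close>,
  the unitary \<open>W\<close> maps \<open>e\<close> to \<open>f\<close> and \<open>f e = W C\<close>. In a two-dimensional picture, \<open>C\<close> is the cosine
  of the angle between \<open>e\<close> and \<open>f\<close>. The slope \<open>2\<close> in \<open>P = e + 2 (1 - e) W e\<close> makes
  \<open>f P = W (2 + C - 2 C\<^sup>2)\<close> large on \<open>e\<close> compared with \<open>(1 - f) P\<close>.\<close>

lemma idempotent_bounded_below:
  assumes T: "T \<in> M"
  obtains P where "P \<in> M" "\<And>x. P (P x) = P x" "\<And>x. (1/4) * norm x \<le> norm (T x - P x)"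
proof -
  obtain K where K: "invariant K" "closed K" and TK: "\<And>x. x \<in> K \<Longrightarrow> adjoint T (T x) \<in> K"
    and T_small: "\<And>x. x \<in> K \<Longrightarrow> 2 * norm (T x) \<le> norm x"
    and T_large: "\<And>x. x \<in> orth K \<Longrightarrow> norm x \<le> 2 * norm (T x)"
    by (rule spectral_splitting[OF T]) (rule that; assumption)
  have cK: "csubspace K" using K(1) by (simp add: invariant_def)
  define e where "e = proj K"
  have e: "e \<in> M" unfolding e_def by (rule proj_mem[OF K])
  note be = bounded_opD[OF M_bounded[OF e]] and bT = bounded_opD[OF M_bounded[OF T]]
  have se: "cinner (e x) y = cinner x (e y)" for x y
    unfolding e_def by (rule proj_selfadjoint[OF cK K(2)])
  have ne: "norm (e x) \<le> norm x" for x unfolding e_def by (rule norm_proj_le[OF cK K(2)])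
  have eK: "e x \<in> K" for x unfolding e_def by (rule proj_in[OF cK K(2)])
  have ee: "e (e x) = e x" for x using eK[of x] by (simp add: e_def proj_of_mem[OF cK K(2)])
  obtain U H where U: "U \<in> M" "\<And>x. norm (U x) = norm x" "\<And>x. U (adjoint U x) = x"
    and TUH: "\<And>x. T x = U (H x)"
    and Hc: "\<forall>R. bounded_op R \<longrightarrow> (\<forall>x. R (adjoint T (T x)) = adjoint T (T (R x))) \<longrightarrow>
      (\<forall>x. R (H x) = H (R x))"
    by (rule polar_decomposition[OF T]) (rule that; assumption)
  define V where "V = adjoint U"
  have V: "V \<in> M" unfolding V_def by (rule M_adjoint[OF U(1)])
  note bU = bounded_opD[OF M_bounded[OF U(1)]] and bV = bounded_opD[OF M_bounded[OF V]]
  have UV: "U (V x) = x" for x by (simp add: V_def U(3))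
  have VU: "V (U x) = x" for x
    using isometry_adjoint[OF M_bounded[OF U(1)] U(2)] by (simp add: V_def fun_eq_iff)
  have nV: "norm (V x) = norm x" for x using U(2)[of "V x"] by (simp add: UV)
  have sU: "cinner (U x) y = cinner x (V y)" "cinner (V x) y = cinner x (U y)" for x y
    unfolding V_def by (rule adjoint[OF M_bounded[OF U(1)]] adjoint'[OF M_bounded[OF U(1)], symmetric])+
  have "e (adjoint T (T x)) = adjoint T (T (e x))" for x
    unfolding e_def
    by (rule proj_reduce[OF cK K(2) M_bounded[OF M_compose[OF M_adjoint[OF T] T]] _ TK])
      (simp add: adjoint[OF M_bounded[OF T], symmetric] adjoint'[OF M_bounded[OF T], symmetric])
  then have eH: "e (H x) = H (e x)" for x using Hc M_bounded[OF e] by blast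
  define f where "f = (\<lambda>x. U (e (V x)))"
  have f: "f \<in> M" unfolding f_def by (rule M_compose[OF U(1) M_compose[OF e V]])
  note bf = bounded_opD[OF M_bounded[OF f]]
  have sf: "cinner (f x) y = cinner x (f y)" for x y by (simp add: f_def sU se)
  have ff: "f (f x) = f x" for x by (simp add: f_def VU ee)
  have nf: "norm (f x) \<le> norm x" for x using ne[of "V x"] by (simp add: f_def U(2) nV)
  have fT: "f (T x) = T (e x)" for x by (simp add: f_def TUH VU eH)
  \<comment> \<open>A block diagonal operator from e, 1 - e to f, 1 - f. Its second block is
    \<open>U\<close> itself, so that the unitary polar factor \<open>W\<close> extends the polar
    part of fe and agrees with \<open>U\<close> off e.\<close>
  define Z where "Z = (\<lambda>x. f (e x) + U (x - e x))"
  have Z: "Z \<in> M" unfolding Z_def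
    by (rule M_add[OF M_compose[OF f e] M_compose[OF U(1) M_diff[OF M_id(2) e]]])
  have adZ: "adjoint Z = (\<lambda>y. e (f y) + (V y - e (V y)))"
    by (rule adjoint_unique[OF M_bounded[OF Z]]) (simp add: Z_def cinner_simps sf se sU)
  have ZZ: "adjoint Z (Z x) = e (f (e x)) + (x - e x)" for x
    unfolding adZ by (simp add: Z_def bf be bV ff VU) (simp add: f_def VU be ee bU(6))
  obtain W C where W: "W \<in> M" "\<And>x. norm (W x) = norm x"
    and C: "C \<in> M" "\<And>x y. cinner (C x) y = cinner x (C y)" "\<And>x. 0 \<le> Re (cinner x (C x))"
      "\<And>x. C (C x) = adjoint Z (Z x)" and ZWC: "\<And>x. Z x = W (C x)"
    and Cc: "\<forall>R. bounded_op R \<longrightarrow> (\<forall>x. R (adjoint Z (Z x)) = adjoint Z (Z (R x))) \<longrightarrow>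
      (\<forall>x. R (C x) = C (R x))"
    by (rule polar_decomposition[OF Z]) (rule that; assumption)
  note bW = bounded_opD[OF M_bounded[OF W(1)]] and bC = bounded_opD[OF M_bounded[OF C(1)]]
  have WW: "cinner (W x) (W y) = cinner x y" for x y
    by (rule isometry_cinner[OF M_bounded[OF W(1)] W(2)])
  have "e (adjoint Z (Z x)) = adjoint Z (Z (e x))" for x by (simp add: ZZ be ee)
  then have eC: "e (C x) = C (e x)" for x using Cc M_bounded[OF e] by blast
  have Ze: "f x = W (C x)" if "e x = x" for x
    using that ZWC[of x] by (simp add: Z_def bU)
  \<comment> \<open>On the kernel of \<open>e\<close> the positive \<open>C\<close> squares to the
    identity, so it is the identity: \<open>C w - w\<close> would be an eigenvector for -1.\<close>
  have W_orth: "W w = U w" if w: "e w = 0" for w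
  proof -
    have "C (C w) = w" by (simp add: C(4) ZZ w bf be)
    define v where "v = C w - w"
    have "C v = - v" using \<open>C (C w) = w\<close> by (simp add: v_def bC)
    then have "0 \<le> - ((norm v)\<^sup>2)"
      using C(3)[of v] by (simp add: cinner_minus_right cinner_self)
    then have "C w = w" by (simp add: v_def)
    then show ?thesis using ZWC[of w] by (simp add: Z_def w bf)
  qed
  \<comment> \<open>\<open>W\<close> carries the kernel of \<open>e\<close> onto the kernel of
    \<open>f\<close>, as \<open>U\<close> does there. Preserving inner products, it sends the range
    of \<open>e\<close> into the orthogonal complement, the range of \<open>f\<close>.\<close>
  have fW: "f (W x) = W x" if x: "e x = x" for x
  proof -
    define z where "z = W x - f (W x)"
    have fz: "f z = 0" by (simp add: z_def bf ff)
    then have "e (V z) = 0" using VU[of "e (V z)"] by (simp add: f_def bV)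
    then have "z = W (V z)" by (simp add: W_orth UV)
    then have "cinner (W x) z = cinner x (V z)" by (metis WW)
    also have "\<dots> = 0" using se[of x "V z"] x \<open>e (V z) = 0\<close> by simp
    finally have "cinner (W x) z = 0" .
    moreover have "cinner (f (W x)) z = 0" by (simp add: sf fz)
    ultimately have "cinner z z = 0" by (simp add: z_def cinner_diff_left)
    then show ?thesis by (simp add: z_def)
  qed
  \<comment> \<open>The compression of \<open>W\<close> to e is the positive operator
    \<open>C\<close> itself; this makes all later norms functions of \<open>C\<close>.\<close>
  have eW: "e (W x) = C x" if x: "e x = x" for x
  proof (rule cinner_eqI)
    fix y
    have "cinner y (e (W x)) = cinner (e y) (f (W x))" by (simp add: fW[OF x] se)
    also have "\<dots> = cinner (W (C (e y))) (W x)" using Ze[of "e y"] by (simp add: sf[symmetric] ee)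
    also have "\<dots> = cinner y (C x)" using eC[of x] x by (simp add: WW C(2) se)
    finally show "cinner y (e (W x)) = cinner y (C x)" .
  qed
  define P where "P = (\<lambda>x. e x + 2 *\<^sub>R (W (e x) - e (W (e x))))"
  have P: "P \<in> M" unfolding P_def
    by (rule M_add[OF e M_scaleR[OF M_diff[OF M_compose[OF W(1) e] M_compose[OF e M_compose[OF W(1) e]]]]])
  \<comment> \<open>\<open>P\<close> depends on its argument only through \<open>e x\<close>, so
    this identity already yields idempotence.\<close>
  have eP: "e (P x) = e x" for x by (simp add: P_def be ee)
  have PP: "P (P x) = P x" for x by (simp add: P_def[of] eP[unfolded P_def])
  have "(1/4) * norm v \<le> norm (T v - P v)" for v
  proof (rule power2_le_imp_le)
    define x where "x = e v"
    define y where "y = v - e v"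
    define q where "q = C x + 2 *\<^sub>R x - 2 *\<^sub>R C (C x)"
    define r where "r = P v - f (P v)"
    have ex: "e x = x" by (simp add: x_def ee)
    have xK: "x \<in> K" unfolding x_def by (rule eK)
    have yK: "y \<in> orth K" unfolding y_def e_def by (rule proj_diff[OF cK K(2)])
    have nv: "(norm v)\<^sup>2 = (norm x)\<^sup>2 + (norm y)\<^sup>2"
      unfolding x_def y_def e_def by (rule norm_sq_proj[OF cK K(2)])
    have eCx: "e (C x) = C x" by (simp add: eC ex)
    have nC: "norm (C z) \<le> norm z" if "e z = z" for z
      using nf[of z] Ze[OF that] W(2)[of "C z"] by simp
    have Pv: "P v = x + 2 *\<^sub>R (W x - C x)" using eW[OF ex] by (simp add: P_def x_def[symmetric])
    have fP: "f (P v) = W q"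
      using Ze[OF ex] Ze[OF eCx] fW[OF ex] by (simp add: Pv bf q_def bW algebra_simps)
    define a where "a = Re (cinner x (C x))"
    define b where "b = (norm (C x))\<^sup>2"
    have ba: "b \<le> a" unfolding a_def b_def
      by (rule positive_contraction_norm_sq_le[OF M_bounded[OF C(1)] C(2,3) nC[OF eCx]])
    have b_le: "b \<le> (norm x)\<^sup>2" unfolding b_def by (intro power_mono nC ex) simp
    \<comment> \<open>Pairing \<open>q\<close> with \<open>x\<close> bounds its norm from below;
      \<open>b \<le> a\<close> then removes \<open>a\<close>, leaving an estimate in
      \<open>b\<close> alone.\<close>
    have "2 * (norm x)\<^sup>2 + a - 2 * b = Re (cinner x q)"
      by (simp add: q_def cinner_simps a_def b_def norm_sq_cinner C(2))
    also have "\<dots> \<le> norm x * norm q" by (rule Re_cinner_le)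
    finally have q_lower: "2 * (norm x)\<^sup>2 - b \<le> norm q * norm x" using ba by (simp add: mult.commute)
    \<comment> \<open>|Pv|^2 computed twice: along e and 1 - e it is |x|^2 + 4 (|x|^2 - b), along f
      and 1 - f it is |q|^2 + |r|^2.\<close>
    have nr: "(norm r)\<^sup>2 = 5 * (norm x)\<^sup>2 - 4 * b - (norm q)\<^sup>2"
    proof -
      have "cinner (C x) (W x - C x) = 0"
        using se[of "C x" "W x"] by (simp add: cinner_simps eCx eW[OF ex])
      then have "(norm (W x))\<^sup>2 = b + (norm (W x - C x))\<^sup>2"
        using norm_sq_add_orthogonal[of "C x" "W x - C x"] by (simp add: b_def)
      moreover have "cinner x (W x - C x) = 0"
        using se[of x "W x"] by (simp add: cinner_simps ex eW[OF ex])
      then have "(norm (P v))\<^sup>2 = (norm x)\<^sup>2 + 4 * (norm (W x - C x))\<^sup>2"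
        unfolding Pv by (subst norm_sq_add_orthogonal) (simp_all add: cinner_scaleR_right power_mult_distrib)
      moreover have "cinner (f (P v)) r = 0" by (simp add: sf r_def bf ff)
      then have "(norm (P v))\<^sup>2 = (norm q)\<^sup>2 + (norm r)\<^sup>2"
        using norm_sq_add_orthogonal[of "f (P v)" r] by (simp add: r_def fP W(2))
      ultimately show ?thesis by (simp add: W(2))
    qed
    have Tv: "T v = T x + T y" by (simp add: x_def y_def flip: bT(2))
    have fTx: "f (T x) = T x" and fTy: "f (T y) = 0" by (simp_all add: fT ex y_def be(3) ee bT(6))
    have split: "(norm (T v - P v))\<^sup>2 = (norm (T x - W q))\<^sup>2 + (norm (T y - r))\<^sup>2"
    proof -
      have fr: "f r = 0" by (simp add: r_def bf ff)
      have "f (T x - W q) = T x - W q" by (simp add: bf fTx ff flip: fP)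
      then have "cinner (T x - W q) (T y - r) = cinner (T x - W q) (f (T y - r))"
        using sf by metis
      then have "cinner (T x - W q) (T y - r) = 0" by (simp add: bf fTy fr)
      from norm_sq_add_orthogonal[OF this] show ?thesis
        by (simp add: Tv r_def fP algebra_simps)
    qed
    have "((norm x)\<^sup>2 + (norm y)\<^sup>2) / 16 \<le> (norm (T x - W q))\<^sup>2 + (norm (T y - r))\<^sup>2"
    proof (rule lower_bound_estimate[of "norm x" b "norm q" "norm r" "norm y" "norm (T y)"])
      show "norm q - norm x / 2 \<le> norm (T x - W q)"
        using T_small[OF xK] norm_triangle_ineq2[of "W q" "T x"] by (simp add: W(2) norm_minus_commute)
      show "\<bar>norm (T y) - norm r\<bar> \<le> norm (T y - r)" by (rule norm_triangle_ineq3)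
    qed (use b_le q_lower nr T_large[OF yK] in \<open>auto simp: b_def\<close>)
    then show "((1/4) * norm v)\<^sup>2 \<le> (norm (T v - P v))\<^sup>2"
      by (simp add: split nv power_divide)
  qed simp
  with P PP show ?thesis by (rule that)
qed

end

theorem theorem1p2:
  fixes M :: "('a::complex_hilbert \<Rightarrow> 'a) set" and T :: "'a \<Rightarrow> 'a"
  assumes "finite_vna M" and "T \<in> M"
  shows "(\<exists>P. idempotent_in M P \<and>
            (\<exists>S\<in>M. S \<circ> (\<lambda>x. T x - P x) = id \<and> (\<lambda>x. T x - P x) \<circ> S = id \<and> onorm S \<le> 4))
         \<and> clean_alg M"
proof -
  interpret finite_vN_algebra M
    using assms(1) by unfold_locales (auto simp: finite_vna_def)
  \<comment> \<open>Stated for an arbitrary element of \<open>M\<close>, since cleanness needs the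
    decomposition for all of them.\<close>
  have main: "\<exists>P. idempotent_in M P \<and>
      (\<exists>S\<in>M. S \<circ> (\<lambda>x. T x - P x) = id \<and> (\<lambda>x. T x - P x) \<circ> S = id \<and> onorm S \<le> 4)"
    if T: "T \<in> M" for T
  proof -
    obtain P where P: "P \<in> M" "\<And>x. P (P x) = P x" "\<And>x. (1/4) * norm x \<le> norm (T x - P x)"
      by (rule idempotent_bounded_below[OF T]) (rule that; assumption)
    obtain S where S: "S \<in> M" "\<And>x. S (T x - P x) = x" "\<And>x. T (S x) - P (S x) = x"
      "\<And>x. (1/4) * norm (S x) \<le> norm x"
    proof (rule bounded_below_invertible[OF M_diff[OF T P(1)] _ P(3)])
      show "0 < (1/4 :: real)" by simp
    qed (rule that; assumption)
    have "norm (S x) \<le> 4 * norm x" for x using S(4)[of x] by simp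
    then have "onorm S \<le> 4" by (intro onorm_bound) simp_all
    then show ?thesis
      using P S by (intro exI[of _ P] conjI bexI[of _ S]) (auto simp: idempotent_in_def fun_eq_iff)
  qed
  moreover have "clean_alg M" unfolding clean_alg_def
  proof
    fix T assume T: "T \<in> M"
    then obtain P S where P: "idempotent_in M P" and S: "S \<in> M" "S \<circ> (\<lambda>x. T x - P x) = id"
      "(\<lambda>x. T x - P x) \<circ> S = id" using main by blast
    have "invertible_in M (\<lambda>x. T x - P x)"
      using M_diff[OF T] P S by (auto simp: invertible_in_def idempotent_in_def)
    with P show "\<exists>U P. invertible_in M U \<and> idempotent_in M P \<and> T = (\<lambda>x. U x + P x)"
      by (intro exI[of _ "\<lambda>x. T x - P x"] exI[of _ P]) simp
  qed
  ultimately show ?thesis using assms(2) by blast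
qed

end
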